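(* Let $(\mathcal{A},\phi)$ be a noncommutative probability space, let $n\ge1$, and let $\{A_l=(a^{(l)}_{ij})_{1\le i,j\le n}\}_{l\in I}$ be an R-cyclic family of matrices in $\mathcal{M}_n(\mathcal{A})$ such that the free cumulants of their entries depend only on the cyclicity of the indices: for every $r\ge1$ and $l_1,\dots,l_r\in I$, the value $\kappa_r\big(a^{(l_1)}_{i_1j_1},\dots,a^{(l_r)}_{i_rj_r}\big)$ is the same for all cyclic indices (i.e. all $i_1,j_1,\dots,i_r,j_r\in\{1,\dots,n\}$ with $j_1=i_2,\dots,j_{r-1}=i_r,\ j_r=i_1$). Denote this common value by $\kappa_r(a^{(l_1)},\dots,a^{(l_r)})$. For $\pi\in NC(m)$ and $\lambda_1,\dots,\lambda_m\in I$ put $$\kappa_\pi\big[a^{(\lambda_1)},\dots,a^{(\lambda_m)}\big]=\prod_{V=\{v_1<\dots<v_r\}\in\pi}\kappa_r\big(a^{(\lambda_{v_1})},\dots,a^{(\lambda_{v_r})}\big).$$ Then for all $s\ge1$, $l_1,\dots,l_s\in I$ and integers $p_1,\dots,p_s\ge1$, with $p=p_1+\dots+p_s$, $$\kappa_s\big(\chi(A_{l_1}^{p_1}),\dots,\chi(A_{l_s}^{p_s})\big)=n^{p+2-s}\sum_{\substack{\pi\in NC(p)\\ \pi\vee\gamma_{\underline p}=1_p}}n^{-|\pi|}\,\kappa_\pi\big[\underbrace{a^{(l_1)},\dots,a^{(l_1)}}_{p_1},\underbrace{a^{(l_2)},\dots,a^{(l_2)}}_{p_2},\dots,\underbrace{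a^{(l_s)},\dots,a^{(l_s)}}_{p_s}\big].$$
   Context: A noncommutative probability space $(\mathcal{A},\phi)$ is a unital complex algebra $\mathcal{A}$ with a unital linear functional $\phi:\mathcal{A}\to\mathbb{C}$. $NC(m)$ is the lattice of noncrossing partitions of $\{1,\dots,m\}$, $1_m$ is the partition with a single block, $\vee$ is the join, and $|\pi|$ is the number of blocks of $\pi$. The free cumulants $\kappa_r:\mathcal{A}^r\to\mathbb{C}$, $r\ge1$, are the multilinear functionals determined by $\phi(a_1\cdots a_m)=\sum_{\pi\in NC(m)}\prod_{V=\{v_1<\dots<v_r\}\in\pi}\kappa_r(a_{v_1},\dots,a_{v_r})$ for all $m\ge1$ and $a_1,\dots,a_m\in\mathcal{A}$. A family of matrices $\{A_l=(a^{(l)}_{ij})_{1\le i,j\le n}\}_{l\in I}$ in $\mathcal{M}_n(\mathcal{A})$ is called R-cyclic if $\kappa_r\big(a^{(l_1)}_{i_1j_1},\dots,a^{(l_r)}_{i_rj_r}\big)=0$, for all $r\ge1$ and $l_1,\dots,l_r\in I$, whenever it is not true that $j_1=i_2$, $j_2=i_3$, …, $j_{r-1}=i_r$ and $j_r=i_1$. For a matrix $A=(a_{ij})\in\mathcal{M}_n(\mathcal{A})$, $\chi(A)=\sum_{i=1}^n a_{ii}$ is the unnormalized trace. For $\underline p=(p_1,\dots,p_s)$ with sum $p$, $\gamma_{\underline p}\in NC(p)$ is the interval partition $\{\{1,\dots,p_1\},\{p_1+1,\dots,p_1+p_2\},\dots,\{p-p_s+1,\dots,p\}\}$. *)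

theory Defs
  imports "HOL-Analysis.Determinants" "HOL-Library.Disjoint_Sets"
begin

text \<open>
  Partitions are taken on \<open>{..<m}\<close> instead of \<open>{1..m}\<close>, so that a block \<open>V\<close> selects the
  sublist \<open>nths xs V\<close> of a list of \<open>m\<close> arguments, in increasing order of the indices.
\<close>

section \<open>Noncrossing partitions\<close>

definition noncrossing :: "nat set set \<Rightarrow> bool" where
  "noncrossing P \<longleftrightarrow>
     (\<forall>V\<in>P. \<forall>W\<in>P. \<forall>a b c d. a < b \<and> b < c \<and> c < d \<and> a \<in> V \<and> c \<in> V \<and> b \<in> W \<and> d \<in> W \<longrightarrow> V = W)"

definition NC :: "nat \<Rightarrow> nat set set set" where
  "NC m = {P. partition_on {..<m} P \<and> noncrossing P}"

text \<open>The join is the one of the lattice \<open>NC m\<close>, not that of the lattice of all partitions.\<close>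

definition is_NC_join :: "nat \<Rightarrow> nat set set \<Rightarrow> nat set set \<Rightarrow> nat set set \<Rightarrow> bool" where
  "is_NC_join m P Q R \<longleftrightarrow>
     R \<in> NC m \<and> refines {..<m} P R \<and> refines {..<m} Q R \<and>
     (\<forall>S\<in>NC m. refines {..<m} P S \<longrightarrow> refines {..<m} Q S \<longrightarrow> refines {..<m} R S)"

definition NC_join :: "nat \<Rightarrow> nat set set \<Rightarrow> nat set set \<Rightarrow> nat set set" where
  "NC_join m P Q = (THE R. is_NC_join m P Q R)"

text \<open>\<open>interval_partition [p\<^sub>1, \<dots>, p\<^sub>s]\<close> is the partition of \<open>{..<p\<^sub>1 + \<dots> + p\<^sub>s}\<close> into consecutive
  intervals of lengths \<open>p\<^sub>1, \<dots>, p\<^sub>s\<close>.\<close>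

definition interval_partition :: "nat list \<Rightarrow> nat set set" where
  "interval_partition ps =
     (\<lambda>k. {sum_list (take k ps)..<sum_list (take (Suc k) ps)}) ` {..<length ps}"

lemma finite_NC: "finite (NC m)"
  by (rule finite_subset[of _ "Pow (Pow {..<m})"]) (auto simp: NC_def partition_on_def)

lemma single_block_in_NC: "m > 0 \<Longrightarrow> {{..<m}} \<in> NC m"
  by (auto simp: NC_def noncrossing_def partition_on_def)

lemma NC_join_exists:
  assumes "P \<in> NC m" "Q \<in> NC m"
  shows "\<exists>R. is_NC_join m P Q R"
proof (cases "m = 0")
  case True
  then have "NC m = {{}}" by (auto simp: NC_def noncrossing_def partition_on_empty)
  then show ?thesis using assms by (auto simp: is_NC_join_def refines_def True partition_on_empty)
next
  case False
  define U where "U = {S \<in> NC m. refines {..<m} P S \<and> refines {..<m} Q S}"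
  have U: "\<And>S. S \<in> U \<Longrightarrow> partition_on {..<m} S" by (auto simp: U_def NC_def)
  have "{{..<m}} \<in> U" using assms single_block_in_NC[of m] False
    by (fastforce simp: U_def NC_def refines_def partition_on_def)
  then have ne: "U \<noteq> {}" by blast
  have "noncrossing (common_refinement U)"
    unfolding noncrossing_def
  proof (intro ballI allI impI)
    fix V W and a b c d :: nat
    assume V: "V \<in> common_refinement U" and W: "W \<in> common_refinement U"
      and abcd: "a < b \<and> b < c \<and> c < d \<and> a \<in> V \<and> c \<in> V \<and> b \<in> W \<and> d \<in> W"
    from V obtain f where f: "f \<in> (\<Pi>\<^sub>E S\<in>U. S)" "V = \<Inter> (f ` U)"
      by (auto simp: common_refinement_def)
    from W obtain g where g: "g \<in> (\<Pi>\<^sub>E S\<in>U. S)" "W = \<Inter> (g ` U)"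
      by (auto simp: common_refinement_def)
    have "f S = g S" if "S \<in> U" for S
    proof -
      have "f S \<in> S" "g S \<in> S" using f g that by auto
      moreover have "a \<in> f S" "c \<in> f S" "b \<in> g S" "d \<in> g S"
        using abcd f g that by auto
      moreover have "noncrossing S" using that by (auto simp: U_def NC_def)
      ultimately show ?thesis using abcd unfolding noncrossing_def by blast
    qed
    then show "V = W" using f g by auto
  qed
  then have "common_refinement U \<in> NC m"
    using partition_on_common_refinement[OF U ne] by (auto simp: NC_def)
  moreover have "refines {..<m} P (common_refinement U)"
    "refines {..<m} Q (common_refinement U)"
    by (rule common_refinement_coarsest[OF U _ _ ne]; use assms in \<open>simp add: NC_def U_def\<close>)+
  moreover have "refines {..<m} (common_refinement U) S"
    if "S \<in> NC m" "refines {..<m} P S" "refines {..<m} Q S" for S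
    using refines_common_refinement[of U "{..<m}" S, OF U] that by (auto simp: U_def)
  ultimately show ?thesis unfolding is_NC_join_def by blast
qed

lemma is_NC_join_NC_join:
  assumes "P \<in> NC m" "Q \<in> NC m"
  shows "is_NC_join m P Q (NC_join m P Q)"
proof -
  obtain R where R: "is_NC_join m P Q R" using NC_join_exists[OF assms] by blast
  have "R' = R" if "is_NC_join m P Q R'" for R'
    using R that by (intro refines_asym[of "{..<m}"]) (auto simp: is_NC_join_def)
  with R have "\<exists>!R. is_NC_join m P Q R" by blast
  then show ?thesis unfolding NC_join_def by (rule theI')
qed

lemma interval_partition_in_NC:
  assumes "\<forall>p\<in>set ps. p \<ge> 1"
  shows "interval_partition ps \<in> NC (sum_list ps)"
proof -
  define s where "s k = sum_list (take k ps)" for k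
  have step: "s (Suc k) = s k + ps ! k" if "k < length ps" for k
    using that by (simp add: s_def take_Suc_conv_app_nth)
  have mono: "s j \<le> s k" if "j \<le> k" for j k
  proof -
    have "take k ps = take j ps @ take (k - j) (drop j ps)"
      using that by (metis le_add_diff_inverse take_add)
    then show ?thesis by (simp add: s_def)
  qed
  have IP: "interval_partition ps = (\<lambda>k. {s k..<s (Suc k)}) ` {..<length ps}"
    by (simp add: interval_partition_def s_def)
  have cover: "(\<Union>k<j. {s k..<s (Suc k)}) = {..<s j}" for j
  proof (induction j)
    case 0
    then show ?case by (simp add: s_def)
  next
    case (Suc j)
    then show ?case using mono[of j "Suc j"] by (auto simp: lessThan_Suc)
  qed
  have uniq: "j = k" if "x \<in> {s j..<s (Suc j)}" "x \<in> {s k..<s (Suc k)}" for j k x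
    using that mono[of "Suc j" k] mono[of "Suc k" j]
    by (meson atLeastLessThan_iff le_less_trans linorder_neqE_nat not_less Suc_leI)
  have "partition_on {..<sum_list ps} (interval_partition ps)"
  proof (rule partition_onI)
    show "\<Union> (interval_partition ps) = {..<sum_list ps}"
      using cover[of "length ps"] by (simp add: IP s_def)
  next
    fix V W assume "V \<in> interval_partition ps" "W \<in> interval_partition ps" "V \<noteq> W"
    then show "disjnt V W" unfolding IP disjnt_def using uniq by blast
  next
    show "{} \<notin> interval_partition ps"
    proof
      assume "{} \<in> interval_partition ps"
      then obtain k where "k < length ps" "{s k..<s (Suc k)} = {}" by (auto simp: IP)
      then show False using step[of k] assms nth_mem[of k ps] by fastforce
    qed
  qed
  moreover have "noncrossing (interval_partition ps)"
    unfolding noncrossing_def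
  proof (intro ballI allI impI)
    fix V W and a b c d :: nat
    assume VW: "V \<in> interval_partition ps" "W \<in> interval_partition ps"
      and *: "a < b \<and> b < c \<and> c < d \<and> a \<in> V \<and> c \<in> V \<and> b \<in> W \<and> d \<in> W"
    then obtain j k where jk: "V = {s j..<s (Suc j)}" "W = {s k..<s (Suc k)}"
      by (auto simp: IP)
    then have "b \<in> V" "b \<in> W" using * by auto
    then show "V = W" using uniq jk by blast
  qed
  ultimately show ?thesis by (simp add: NC_def)
qed


section \<open>Noncommutative probability spaces and free cumulants\<close>

text \<open>The algebra is the whole type \<open>'a\<close>; its complex structure is the explicit scalar
  multiplication \<open>smul\<close>, as the libraries have no class of complex algebras.\<close>

locale nc_prob_space =
  Vector_Spaces.linear smul "(*)" \<phi>
  for smul :: "complex \<Rightarrow> 'a::ring_1 \<Rightarrow> 'a" and \<phi> :: "'a \<Rightarrow> complex" +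
  assumes smul_mult_left: "smul c x * y = smul c (x * y)"
    and smul_mult_right: "x * smul c y = smul c (x * y)"
    and unital: "\<phi> 1 = 1"

text \<open>Multilinear functionals \<open>\<kappa>\<^sub>r\<close>, \<open>r \<ge> 1\<close>, are given by one function \<open>\<kappa>\<close> on lists; its value
  at the empty list is irrelevant.\<close>

definition multilinear :: "(complex \<Rightarrow> 'a::ring_1 \<Rightarrow> 'a) \<Rightarrow> ('a list \<Rightarrow> complex) \<Rightarrow> bool" where
  "multilinear smul \<kappa> \<longleftrightarrow>
     (\<forall>xs ys. Vector_Spaces.linear smul (*) (\<lambda>x. \<kappa> (xs @ x # ys)))"

definition block_prod :: "('b list \<Rightarrow> complex) \<Rightarrow> nat set set \<Rightarrow> 'b list \<Rightarrow> complex" where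
  "block_prod \<kappa> P xs = (\<Prod>V\<in>P. \<kappa> (nths xs V))"

definition free_cumulants ::
  "(complex \<Rightarrow> 'a::ring_1 \<Rightarrow> 'a) \<Rightarrow> ('a \<Rightarrow> complex) \<Rightarrow> ('a list \<Rightarrow> complex) \<Rightarrow> bool" where
  "free_cumulants smul \<phi> \<kappa> \<longleftrightarrow> multilinear smul \<kappa> \<and>
     (\<forall>xs. xs \<noteq> [] \<longrightarrow> \<phi> (prod_list xs) = (\<Sum>P\<in>NC (length xs). block_prod \<kappa> P xs))"

text \<open>\<open>free_cumulants\<close> determines \<open>\<kappa>\<close> on nonempty lists, and \<open>cumulant \<phi>\<close> below always satisfies it.\<close>

lemma length_nths_less:
  assumes "P \<in> NC (length xs)" "P \<noteq> {{..<length xs}}" "V \<in> P"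
  shows "length (nths xs V) < length xs"
proof -
  have part: "partition_on {..<length xs} P" using assms(1) by (simp add: NC_def)
  have sub: "V \<subseteq> {..<length xs}" "V \<noteq> {}" 
    using part assms(3) by (auto simp: partition_on_def)
  have "V \<noteq> {..<length xs}"
  proof
    assume V: "V = {..<length xs}"
    have "W = V" if "W \<in> P" for W
    proof (rule ccontr)
      assume "W \<noteq> V"
      then have "W \<inter> V = {}" using part that assms(3)
        by (auto simp: partition_on_def disjoint_def)
      moreover have "W \<subseteq> V" "W \<noteq> {}" using part that by (auto simp: V partition_on_def)
      ultimately show False by blast
    qed
    then have "P = {V}" using assms(3) by blast
    then show False using V assms(2) by simp
  qed
  then have "{i. i < length xs \<and> i \<in> V} \<subset> {..<length xs}" using sub by auto
  then have "card {i. i < length xs \<and> i \<in> V} < card {..<length xs}"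
    by (intro psubset_card_mono) auto
  then show ?thesis by (simp add: length_nths)
qed

lemma block_prod_single: "block_prod \<kappa> {{..<length xs}} xs = \<kappa> xs"
  by (simp add: block_prod_def)

lemma free_cumulants_recursion:
  assumes "free_cumulants smul \<phi> \<kappa>" "xs \<noteq> []"
  shows "\<kappa> xs = \<phi> (prod_list xs) -
           (\<Sum>P\<in>NC (length xs) - {{{..<length xs}}}. block_prod \<kappa> P xs)"
proof -
  have "{{..<length xs}} \<in> NC (length xs)" using assms(2) by (simp add: single_block_in_NC)
  then have "(\<Sum>P\<in>NC (length xs). block_prod \<kappa> P xs) =
      \<kappa> xs + (\<Sum>P\<in>NC (length xs) - {{{..<length xs}}}. block_prod \<kappa> P xs)"
    by (subst sum.remove[OF finite_NC]) (auto simp: block_prod_single)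
  then show ?thesis using assms by (simp add: free_cumulants_def)
qed

lemma nths_block_nonempty:
  assumes "P \<in> NC (length xs)" "V \<in> P"
  shows "nths xs V \<noteq> []"
proof -
  have "partition_on {..<length xs} P" using assms(1) by (simp add: NC_def)
  then have "V \<subseteq> {..<length xs}" "V \<noteq> {}"
    using assms(2) by (auto simp: partition_on_def)
  then obtain i where "i \<in> V" "i < length xs" by auto
  then have "xs ! i \<in> set (nths xs V)" by (auto simp: set_nths)
  then show ?thesis by auto
qed

lemma free_cumulants_unique:
  assumes "free_cumulants smul \<phi> \<kappa>" "free_cumulants smul \<phi> \<kappa>'" "xs \<noteq> []"
  shows "\<kappa> xs = \<kappa>' xs"
  using assms(3)
proof (induction xs rule: length_induct)
  case (1 xs)
  have "block_prod \<kappa> P xs = block_prod \<kappa>' P xs"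
    if "P \<in> NC (length xs) - {{{..<length xs}}}" for P
    unfolding block_prod_def
  proof (intro prod.cong refl)
    fix V assume "V \<in> P"
    then have "length (nths xs V) < length xs" "nths xs V \<noteq> []"
      using that length_nths_less[of P xs V] nths_block_nonempty[of P xs V] by blast+
    then show "\<kappa> (nths xs V) = \<kappa>' (nths xs V)" using 1(1) by blast
  qed
  then show ?case
    using free_cumulants_recursion[OF assms(1) 1(2)] free_cumulants_recursion[OF assms(2) 1(2)]
    by simp
qed

function cumulant :: "('a::ring_1 \<Rightarrow> complex) \<Rightarrow> 'a list \<Rightarrow> complex" where
  "cumulant \<phi> xs = \<phi> (prod_list xs) -
     (\<Sum>P\<in>NC (length xs) - {{{..<length xs}}}. \<Prod>V\<in>P. cumulant \<phi> (nths xs V))"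
  by pat_completeness auto
termination
proof (relation "measure (\<lambda>(\<phi>, xs). length xs)")
  fix \<phi> :: "'a \<Rightarrow> complex" and xs :: "'a list" and P V
  assume "P \<in> NC (length xs) - {{{..<length xs}}}" "V \<in> P"
  then show "((\<phi>, nths xs V), (\<phi>, xs)) \<in> measure (\<lambda>(\<phi>, xs). length xs)"
    using length_nths_less[of P xs V] by (simp only: in_measure prod.case) blast
qed simp

declare cumulant.simps [simp del]

lemma linear_functional_iff:
  assumes "vector_space (smul :: complex \<Rightarrow> 'a::ring_1 \<Rightarrow> 'a)"
  shows "Vector_Spaces.linear smul (*) f \<longleftrightarrow>
    (\<forall>x y. f (x + y) = f x + f y) \<and> (\<forall>c x. f (smul c x) = c * f x)"
proof -
  have v: "vector_space ((*) :: complex \<Rightarrow> _)" by unfold_locales (auto simp: algebra_simps)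
  show ?thesis
    using assms v
    by (simp add: Vector_Spaces.linear_def module_hom_def module_hom_axioms_def module_iff_vector_space)
qed

theorem free_cumulants_cumulant:
  assumes "nc_prob_space smul \<phi>"
  shows "free_cumulants smul \<phi> (cumulant \<phi>)"
proof -
  interpret nc_prob_space smul \<phi> by fact
  note lin = linear_functional_iff[OF vs1.vector_space_axioms]
  have phi: "\<phi> (x + y) = \<phi> x + \<phi> y" "\<phi> (smul c x) = c * \<phi> x" for x y c
    by (simp_all add: add scale)
  have "\<forall>xs ys. k = length (xs @ ys) \<longrightarrow>
      Vector_Spaces.linear smul (*) (\<lambda>x. cumulant \<phi> (xs @ x # ys))" for k
  proof (induction k rule: less_induct)
    case (less k)
    show ?case
    proof (intro allI impI)
      fix xs ys :: "'a list" assume k: "k = length (xs @ ys)"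
      define n where "n = Suc (length (xs @ ys))"
      have blk: "\<exists>f C. (\<forall>x y. f (x + y) = f x + f y) \<and> (\<forall>c x. f (smul c x) = c * f x) \<and>
          (\<forall>x. (\<Prod>V\<in>P. cumulant \<phi> (nths (xs @ x # ys) V)) = f x * C)"
        if P: "P \<in> NC n - {{{..<n}}}" for P
      proof -
        have part: "partition_on {..<n} P" using P by (simp add: NC_def)
        have finP: "finite P" using part by (rule finite_elements[OF finite_lessThan])
        have "length xs \<in> \<Union>P" using part by (simp add: partition_on_def n_def)
        then obtain V where V: "V \<in> P" "length xs \<in> V" by blast
        have notin: "length xs \<notin> W" if "W \<in> P - {V}" for W
          using part V that by (auto simp: partition_on_def disjoint_def)
        define us where "us W = nths xs W" for W
        define vs where "vs W = nths ys {j. Suc (j + length xs) \<in> W}" for W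
        have nths: "nths (xs @ x # ys) W =
            us W @ (if length xs \<in> W then [x] else []) @ vs W" for x W
          by (simp add: us_def vs_def nths_append nths_Cons)
        have "length (nths (xs @ 0 # ys) V) < length (xs @ 0 # ys)"
          using P V by (intro length_nths_less[of P]) (auto simp: n_def)
        then have "length (us V @ vs V) < k" using V by (simp add: nths k)
        then have L: "Vector_Spaces.linear smul (*) (\<lambda>x. cumulant \<phi> (us V @ x # vs V))"
          using less by blast
        show ?thesis
        proof (intro exI conjI)
          show "\<forall>x. (\<Prod>W\<in>P. cumulant \<phi> (nths (xs @ x # ys) W)) =
              cumulant \<phi> (us V @ x # vs V) * (\<Prod>W\<in>P - {V}. cumulant \<phi> (us W @ vs W))"
          proof
            fix x
            have "(\<Prod>W\<in>P. cumulant \<phi> (nths (xs @ x # ys) W)) =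
                cumulant \<phi> (nths (xs @ x # ys) V) *
                (\<Prod>W\<in>P - {V}. cumulant \<phi> (nths (xs @ x # ys) W))"
              using finP V(1) by (rule prod.remove)
            also have "(\<Prod>W\<in>P - {V}. cumulant \<phi> (nths (xs @ x # ys) W)) =
                (\<Prod>W\<in>P - {V}. cumulant \<phi> (us W @ vs W))"
              using notin by (intro prod.cong refl) (simp add: nths)
            finally show "(\<Prod>W\<in>P. cumulant \<phi> (nths (xs @ x # ys) W)) =
              cumulant \<phi> (us V @ x # vs V) * (\<Prod>W\<in>P - {V}. cumulant \<phi> (us W @ vs W))"
              using V(2) by (simp add: nths)
          qed
        qed (use L lin in auto)
      qed
      have "\<forall>P\<in>NC n - {{{..<n}}}. \<exists>f C.
          (\<forall>x y. f (x + y) = f x + f y) \<and> (\<forall>c x. f (smul c x) = c * f x) \<and>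
          (\<forall>x. (\<Prod>V\<in>P. cumulant \<phi> (nths (xs @ x # ys) V)) = f x * C)"
        using blk by blast
      then obtain F C where FC: "\<And>P. P \<in> NC n - {{{..<n}}} \<Longrightarrow>
          (\<forall>x y. F P (x + y) = F P x + F P y) \<and> (\<forall>c x. F P (smul c x) = c * F P x) \<and>
          (\<forall>x. (\<Prod>V\<in>P. cumulant \<phi> (nths (xs @ x # ys) V)) = F P x * C P)"
        by metis
      have eq: "cumulant \<phi> (xs @ x # ys) =
          \<phi> (prod_list xs * x * prod_list ys) - (\<Sum>P\<in>NC n - {{{..<n}}}. F P x * C P)" for x
      proof -
        have "(\<Sum>P\<in>NC n - {{{..<n}}}. \<Prod>V\<in>P. cumulant \<phi> (nths (xs @ x # ys) V)) =
            (\<Sum>P\<in>NC n - {{{..<n}}}. F P x * C P)"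
          using FC by (intro sum.cong refl) blast
        then show ?thesis
          by (subst cumulant.simps) (simp add: n_def mult.assoc)
      qed
      show "Vector_Spaces.linear smul (*) (\<lambda>x. cumulant \<phi> (xs @ x # ys))"
        unfolding lin
      proof (intro conjI allI)
        fix x y
        have "(\<Sum>P\<in>NC n - {{{..<n}}}. F P (x + y) * C P) =
            (\<Sum>P\<in>NC n - {{{..<n}}}. F P x * C P) + (\<Sum>P\<in>NC n - {{{..<n}}}. F P y * C P)"
          unfolding sum.distrib[symmetric] using FC
          by (intro sum.cong refl) (simp add: distrib_right)
        then show "cumulant \<phi> (xs @ (x + y) # ys) =
            cumulant \<phi> (xs @ x # ys) + cumulant \<phi> (xs @ y # ys)"
          by (simp add: eq phi ring_distribs)
      next
        fix c x
        have "(\<Sum>P\<in>NC n - {{{..<n}}}. F P (smul c x) * C P) =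
            c * (\<Sum>P\<in>NC n - {{{..<n}}}. F P x * C P)"
          unfolding sum_distrib_left using FC by (intro sum.cong refl) simp
        then show "cumulant \<phi> (xs @ smul c x # ys) = c * cumulant \<phi> (xs @ x # ys)"
          by (simp add: eq phi smul_mult_left smul_mult_right right_diff_distrib)
      qed
    qed
  qed
  then have "multilinear smul (cumulant \<phi>)" by (simp add: multilinear_def)
  moreover have "\<phi> (prod_list xs) = (\<Sum>P\<in>NC (length xs). block_prod (cumulant \<phi>) P xs)"
    if "xs \<noteq> []" for xs
  proof -
    have "{{..<length xs}} \<in> NC (length xs)" using that by (simp add: single_block_in_NC)
    then have "(\<Sum>P\<in>NC (length xs). block_prod (cumulant \<phi>) P xs) = cumulant \<phi> xs +
        (\<Sum>P\<in>NC (length xs) - {{{..<length xs}}}. block_prod (cumulant \<phi>) P xs)"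
      by (subst sum.remove[OF finite_NC]) (auto simp: block_prod_single)
    moreover have "cumulant \<phi> xs = \<phi> (prod_list xs) -
        (\<Sum>P\<in>NC (length xs) - {{{..<length xs}}}. block_prod (cumulant \<phi>) P xs)"
      by (subst cumulant.simps) (simp add: block_prod_def)
    ultimately show ?thesis by simp
  qed
  ultimately show ?thesis by (simp add: free_cumulants_def)
qed


section \<open>R-cyclic families of matrices\<close>

text \<open>The list \<open>[(i\<^sub>1, j\<^sub>1), \<dots>, (i\<^sub>r, j\<^sub>r)]\<close> is cyclic if \<open>j\<^sub>1 = i\<^sub>2, \<dots>, j\<^sub>r\<^sub>-\<^sub>1 = i\<^sub>r, j\<^sub>r = i\<^sub>1\<close>.\<close>

definition cyclic_indices :: "('n \<times> 'n) list \<Rightarrow> bool" where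
  "cyclic_indices ijs \<longleftrightarrow>
     (\<forall>k<length ijs. snd (ijs ! k) = fst (ijs ! (Suc k mod length ijs)))"

definition entries :: "('i \<Rightarrow> 'a^'n^'n) \<Rightarrow> 'i list \<Rightarrow> ('n \<times> 'n) list \<Rightarrow> 'a list" where
  "entries A ls ijs = map2 (\<lambda>l (i, j). A l $ i $ j) ls ijs"

definition R_cyclic :: "('a list \<Rightarrow> complex) \<Rightarrow> ('i \<Rightarrow> 'a^'n^'n) \<Rightarrow> bool" where
  "R_cyclic \<kappa> A \<longleftrightarrow>
     (\<forall>ls ijs. ls \<noteq> [] \<longrightarrow> length ijs = length ls \<longrightarrow> \<not> cyclic_indices ijs \<longrightarrow>
        \<kappa> (entries A ls ijs) = 0)"

text \<open>The cumulants of the entries at cyclic indices do not depend on the indices, and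
  \<open>c [l\<^sub>1, \<dots>, l\<^sub>r]\<close> is their common value.\<close>

definition common_cyclic_cumulants ::
  "('a list \<Rightarrow> complex) \<Rightarrow> ('i \<Rightarrow> 'a^'n^'n) \<Rightarrow> ('i list \<Rightarrow> complex) \<Rightarrow> bool" where
  "common_cyclic_cumulants \<kappa> A c \<longleftrightarrow>
     (\<forall>ls ijs. ls \<noteq> [] \<longrightarrow> length ijs = length ls \<longrightarrow> cyclic_indices ijs \<longrightarrow>
        \<kappa> (entries A ls ijs) = c ls)"

text \<open>Powers with respect to the matrix product; the instance of \<open>(^)\<close> for vectors is
  componentwise.\<close>

definition mat_power :: "'a::semiring_1^'n^'n \<Rightarrow> nat \<Rightarrow> 'a^'n^'n" where
  "mat_power M p = ((**) M ^^ p) (mat 1)"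

end

theory Submission
  imports Defs
begin

text \<open>
  Expanding the traces of powers by multilinearity writes the left-hand side as a sum, over all index
  lists \<open>i\<close> of length \<open>p\<close>, of cumulants of products of entries. The formula for cumulants with
  products as arguments turns each summand into a sum over the partitions \<open>\<pi>\<close> with
  \<open>\<pi> \<or> \<gamma> = 1\<close>. By R-cyclicity \<open>\<pi>\<close> contributes \<open>\<kappa>\<^sub>\<pi>\<close> if \<open>i (\<gamma> x) = i (\<pi> x)\<close> for all \<open>x\<close> and \<open>0\<close> otherwise,
  where a partition is also read as the permutation that rotates its blocks. It remains to see that
  this system has \<open>n ^ (p + 2 - s - card \<pi>)\<close> solutions. If \<open>\<pi>\<close> has more than one block, then by
  \<open>\<pi> \<or> \<gamma> = 1\<close> some interval of \<open>\<gamma>\<close> contains \<open>v\<close> and \<open>v + 1\<close> in different blocks of \<open>\<pi>\<close>; merging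
  these two blocks keeps \<open>\<pi>\<close> noncrossing and frees exactly the index \<open>i (v + 1)\<close>, so it multiplies the
  number of solutions by \<open>n\<close>. For \<open>\<pi> = 1\<close> the system says that \<open>i\<close> is constant on the left endpoints
  of the \<open>s\<close> intervals.
\<close>

section \<open>Noncrossing partitions above a given interval partition\<close>

text \<open>The ground set is arbitrary because blocks and unions of intervals serve as ground sets
  below; \<open>NC\<close> is the case of initial segments.\<close>

definition ncp :: "nat set \<Rightarrow> nat set set set" where
  "ncp U = {P. partition_on U P \<and> noncrossing P}"

text \<open>
  The fibres of a monotone \<open>b\<close> are the blocks of an interval partition \<open>\<gamma>\<close>. Then \<open>sat_ncp b U\<close> consists
  of the noncrossing partitions of \<open>U\<close> that are coarser than \<open>\<gamma>\<close>, and \<open>conn_ncp b U\<close> of those whose join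
  with \<open>\<gamma>\<close> is the one-block partition.
\<close>

definition saturated :: "(nat \<Rightarrow> nat) \<Rightarrow> nat set \<Rightarrow> nat set \<Rightarrow> bool" where
  "saturated b U V \<longleftrightarrow> (\<forall>x\<in>V. \<forall>y\<in>U. b x = b y \<longrightarrow> y \<in> V)"

definition sat_ncp :: "(nat \<Rightarrow> nat) \<Rightarrow> nat set \<Rightarrow> nat set set set" where
  "sat_ncp b U = {S \<in> ncp U. \<forall>V\<in>S. saturated b U V}"

definition finer :: "nat set set \<Rightarrow> nat set set \<Rightarrow> bool" where
  "finer P S \<longleftrightarrow> (\<forall>B\<in>P. \<exists>V\<in>S. B \<subseteq> V)"

definition conn_ncp :: "(nat \<Rightarrow> nat) \<Rightarrow> nat set \<Rightarrow> nat set set set" where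
  "conn_ncp b U = {P \<in> ncp U. \<forall>S\<in>sat_ncp b U. finer P S \<longrightarrow> S = {U}}"

lemma NC_eq_ncp: "NC m = ncp {..<m}"
  by (simp add: NC_def ncp_def)

section \<open>Elementary facts on noncrossing partitions of a set\<close>

lemma partition_on_block_unique:
  assumes "partition_on U P" "V \<in> P" "W \<in> P" "x \<in> V" "x \<in> W"
  shows "V = W"
  using partition_onD2[OF assms(1), unfolded disjoint_def] assms(2-5) by blast

lemma ncp_block_unique: "P \<in> ncp U \<Longrightarrow> V \<in> P \<Longrightarrow> W \<in> P \<Longrightarrow> x \<in> V \<Longrightarrow> x \<in> W \<Longrightarrow> V = W"
  unfolding ncp_def by (metis (no_types, lifting) mem_Collect_eq partition_on_block_unique)

lemma ncp_subset: "P \<in> ncp U \<Longrightarrow> V \<in> P \<Longrightarrow> V \<subseteq> U"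
  by (auto simp: ncp_def partition_on_def)

lemma ncp_nonempty: "P \<in> ncp U \<Longrightarrow> V \<in> P \<Longrightarrow> V \<noteq> {}"
  by (auto simp: ncp_def partition_on_def)

lemma ncp_cover: "P \<in> ncp U \<Longrightarrow> x \<in> U \<Longrightarrow> \<exists>V\<in>P. x \<in> V"
  by (auto simp: ncp_def partition_on_def)

lemma noncrossingD:
  "P \<in> ncp U \<Longrightarrow> V \<in> P \<Longrightarrow> W \<in> P \<Longrightarrow> x < y \<Longrightarrow> y < z \<Longrightarrow> z < w \<Longrightarrow>
    x \<in> V \<Longrightarrow> z \<in> V \<Longrightarrow> y \<in> W \<Longrightarrow> w \<in> W \<Longrightarrow> V = W"
  unfolding ncp_def noncrossing_def by blast

lemma ncpI:
  assumes "\<Union>P = U" "{} \<notin> P"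
    and "\<And>V W x. V \<in> P \<Longrightarrow> W \<in> P \<Longrightarrow> x \<in> V \<Longrightarrow> x \<in> W \<Longrightarrow> V = W"
    and "\<And>V W x y z w. V \<in> P \<Longrightarrow> W \<in> P \<Longrightarrow> x < y \<Longrightarrow> y < z \<Longrightarrow> z < w \<Longrightarrow>
           x \<in> V \<Longrightarrow> z \<in> V \<Longrightarrow> y \<in> W \<Longrightarrow> w \<in> W \<Longrightarrow> V = W"
  shows "P \<in> ncp U"
proof -
  have "disjnt V W" if "V \<in> P" "W \<in> P" "V \<noteq> W" for V W
    using assms(3)[OF that(1,2)] that(3) unfolding disjnt_iff by blast
  then have "partition_on U P"
    using assms(1,2) by (intro partition_onI)
  moreover have "noncrossing P"
    unfolding noncrossing_def using assms(4) by blast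
  ultimately show ?thesis by (simp add: ncp_def)
qed

lemma finite_ncp: "finite U \<Longrightarrow> finite (ncp U)"
  unfolding ncp_def by (rule finite_subset[OF _ finitely_many_partition_on]) auto

lemma finite_ncp_elem: "finite U \<Longrightarrow> P \<in> ncp U \<Longrightarrow> finite P"
  unfolding ncp_def using finite_elements by blast

lemma single_block_in_ncp: "U \<noteq> {} \<Longrightarrow> {U} \<in> ncp U"
  by (rule ncpI) auto

lemma single_block_in_sat_ncp: "U \<noteq> {} \<Longrightarrow> {U} \<in> sat_ncp b U"
  by (auto simp: sat_ncp_def single_block_in_ncp saturated_def)

lemma ncp_eq_single_block: "P \<in> ncp U \<Longrightarrow> U \<in> P \<Longrightarrow> P = {U}"
proof -
  assume P: "P \<in> ncp U" "U \<in> P"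
  have "V = U" if V: "V \<in> P" for V
  proof -
    obtain x where "x \<in> V" using ncp_nonempty[OF P(1) V] by blast
    then show ?thesis using ncp_block_unique[OF P(1) V P(2)] ncp_subset[OF P(1) V] by blast
  qed
  then show "P = {U}" using P by blast
qed

text \<open>Saturated blocks are unions of fibres of \<open>b\<close>, so preimages and images under
  \<open>b\<close> are mutually inverse. As \<open>b\<close> preserves the weak order and reflects
  the strict one, neither direction creates a crossing.\<close>

lemma bij_betw_ncp_sat_ncp:
  assumes mono: "mono_on U b" and onto: "b ` U = W"
  shows "bij_betw (\<lambda>P. (\<lambda>V. b -` V \<inter> U) ` P) (ncp W) (sat_ncp b U)"
proof -
  define h where "h V = b -` V \<inter> U" for V
  have bh: "b ` h V = V" if "V \<subseteq> W" for V
    using that onto unfolding h_def by blast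
  have img: "(`) b ` h ` P = P" if "P \<in> ncp W" for P
  proof -
    have "b ` h V = V" if "V \<in> P" for V
      by (rule bh[OF ncp_subset[OF \<open>P \<in> ncp W\<close> that]])
    then have "(\<lambda>V. b ` h V) ` P = (\<lambda>V. V) ` P" by (intro image_cong) auto
    then show ?thesis by (simp add: image_image)
  qed
  have order: "x < y" if "b x < b y" "x \<in> U" "y \<in> U" for x y
    using mono that by (meson linorder_not_le mono_onD)
  have le: "b x \<le> b y" if "x < y" "x \<in> U" "y \<in> U" for x y
    using mono that by (meson less_imp_le mono_onD)
  have to: "h ` P \<in> sat_ncp b U" if P: "P \<in> ncp W" for P
  proof -
    have ex: "\<exists>V\<in>P. b x \<in> V" if "x \<in> U" for x
      using ncp_cover[OF P] onto that by blast
    have "h ` P \<in> ncp U"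
    proof (rule ncpI)
      show "\<Union>(h ` P) = U" using ex by (auto simp: h_def)
      show "{} \<notin> h ` P"
      proof
        assume "{} \<in> h ` P"
        then obtain V where "V \<in> P" "h V = {}" by auto
        then show False using bh[of V] ncp_subset[OF P] ncp_nonempty[OF P] by auto
      qed
    next
      fix V' W' x assume "V' \<in> h ` P" "W' \<in> h ` P" "x \<in> V'" "x \<in> W'"
      then show "V' = W'" using ncp_block_unique[OF P] by (auto simp: h_def)
    next
      fix V' W' x y z w
      assume a: "V' \<in> h ` P" "W' \<in> h ` P" and o: "x < y" "y < z" "z < w"
        and m: "x \<in> V'" "z \<in> V'" "y \<in> W'" "w \<in> W'"
      then obtain V1 W1 where 1: "V1 \<in> P" "W1 \<in> P" "V' = h V1" "W' = h W1" by blast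
      have m1: "b x \<in> V1" "b z \<in> V1" "b y \<in> W1" "b w \<in> W1"
        and U: "x \<in> U" "y \<in> U" "z \<in> U" "w \<in> U"
        using m 1 by (auto simp: h_def)
      have l: "b x \<le> b y" "b y \<le> b z" "b z \<le> b w" using le o U by auto
      have "V1 = W1"
      \<comment> \<open>Images of different points may coincide, but each of these equalities gives
        \<open>V1\<close> and \<open>W1\<close> a common point.\<close>
      proof (cases "b x = b y \<or> b y = b z \<or> b z = b w")
        case True
        then show ?thesis using ncp_block_unique[OF P 1(1,2)] m1 by metis
      next
        case False
        then show ?thesis using noncrossingD[OF P 1(1,2), of "b x" "b y" "b z" "b w"] l m1 by linarith
      qed
      then show "V' = W'" using 1 by simp
    qed
    then show ?thesis
      by (auto simp: sat_ncp_def saturated_def h_def)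
  qed
  have from': "(`) b ` S \<in> ncp W" "h ` (`) b ` S = S" if S: "S \<in> sat_ncp b U" for S
  proof -
    have Sn: "S \<in> ncp U" using S by (simp add: sat_ncp_def)
    have hb: "h (b ` V) = V" if "V \<in> S" for V
    proof -
      have "saturated b U V" "V \<subseteq> U" using S that ncp_subset by (auto simp: sat_ncp_def)
      then show ?thesis by (auto simp: h_def saturated_def)
    qed
    then have "(\<lambda>V. h (b ` V)) ` S = (\<lambda>V. V) ` S" by (intro image_cong) auto
    then show "h ` (`) b ` S = S" by (simp add: image_image)
    have sat: "y \<in> V" if "x \<in> V" "y \<in> U" "b x = b y" "V \<in> S" for x y V
      using S that by (auto simp: sat_ncp_def saturated_def)
    show "(`) b ` S \<in> ncp W"
    proof (rule ncpI)
      have "\<Union>S = U" using Sn by (simp add: ncp_def partition_on_def)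
      then show "\<Union>((`) b ` S) = W" using onto by blast
      show "{} \<notin> (`) b ` S" using ncp_nonempty[OF Sn] by auto
    next
      fix V W x assume "V \<in> (`) b ` S" "W \<in> (`) b ` S" "x \<in> V" "x \<in> W"
      then obtain V1 W1 x1 x2 where 1: "V1 \<in> S" "W1 \<in> S" "V = b ` V1" "W = b ` W1"
        "x1 \<in> V1" "x2 \<in> W1" "b x1 = b x2" by blast
      then have "x2 \<in> V1" using sat ncp_subset[OF Sn] by blast
      then show "V = W" using ncp_block_unique[OF Sn] 1 by blast
    next
      fix V W x y z w assume a: "V \<in> (`) b ` S" "W \<in> (`) b ` S"
       and o: "x < y" "y < z" "z < w" and m: "x \<in> V" "z \<in> V" "y \<in> W" "w \<in> W"
      then obtain V1 W1 where 1: "V1 \<in> S" "W1 \<in> S" "V = b ` V1" "W = b ` W1" by blast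
      then obtain x' y' z' w' where 2: "x' \<in> V1" "z' \<in> V1" "y' \<in> W1" "w' \<in> W1"
        "x = b x'" "y = b y'" "z = b z'" "w = b w'" using m by blast
      moreover have "x' \<in> U" "y' \<in> U" "z' \<in> U" "w' \<in> U" using 1 2 ncp_subset[OF Sn] by auto
      ultimately have "x' < y'" "y' < z'" "z' < w'" using o order by auto
      then show "V = W" using noncrossingD[OF Sn 1(1,2)] 1 2 by blast
    qed
  qed
  have "bij_betw (\<lambda>P. h ` P) (ncp W) (sat_ncp b U)"
    by (rule bij_betw_byWitness[where f' = "\<lambda>S. (`) b ` S"])
      (use img to from' in \<open>auto simp: image_subset_iff\<close>)
  then show ?thesis by (simp add: h_def)
qed

section \<open>Restriction to blocks and gluing over blocks\<close>

lemma restrict_ncp: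
  assumes "P \<in> ncp U" "S \<in> ncp U" "finer P S" "V \<in> S"
  shows "{B \<in> P. B \<subseteq> V} \<in> ncp V"
proof -
  have "refines U P S" using assms by (auto simp: refines_def ncp_def finer_def)
  then have "partition_on V {B \<in> P. B \<subseteq> V}" using assms(4) by (rule refines_obtains_subset)
  then show ?thesis using assms(1) by (auto simp: ncp_def noncrossing_def)
qed

text \<open>A crossing of two glued blocks would also be a crossing of the blocks of
  \<open>S\<close> that contain them. Hence both lie over the same \<open>V\<close>, and
  \<open>h V\<close> is noncrossing.\<close>

lemma Union_ncp:
  assumes S: "S \<in> ncp U" and h: "\<And>V. V \<in> S \<Longrightarrow> h V \<in> ncp V"
  shows "\<Union>(h ` S) \<in> ncp U"
proof (rule ncpI)
  have "\<Union>(h V) = V" if "V \<in> S" for V using h[OF that] by (simp add: ncp_def partition_on_def)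
  moreover have "\<Union>S = U" using S by (simp add: ncp_def partition_on_def)
  ultimately show "\<Union>(\<Union>(h ` S)) = U" by blast
  show "{} \<notin> \<Union>(h ` S)" using h ncp_nonempty by blast
next
  fix X Y x assume "X \<in> \<Union>(h ` S)" "Y \<in> \<Union>(h ` S)" "x \<in> X" "x \<in> Y"
  then obtain V W where 1: "V \<in> S" "W \<in> S" "X \<in> h V" "Y \<in> h W" by blast
  then have "x \<in> V" "x \<in> W" using h ncp_subset \<open>x \<in> X\<close> \<open>x \<in> Y\<close> by blast+
  then have "V = W" using 1 ncp_block_unique[OF S] by blast
  then show "X = Y" using 1 h ncp_block_unique \<open>x \<in> X\<close> \<open>x \<in> Y\<close> by blast
next
  fix X Y x y z w assume "X \<in> \<Union>(h ` S)" "Y \<in> \<Union>(h ` S)"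
    and o: "x < y" "y < z" "z < w" and m: "x \<in> X" "z \<in> X" "y \<in> Y" "w \<in> Y"
  then obtain V W where 1: "V \<in> S" "W \<in> S" "X \<in> h V" "Y \<in> h W" by blast
  then have "x \<in> V" "z \<in> V" "y \<in> W" "w \<in> W" using h ncp_subset m by blast+
  then have "V = W" using 1 noncrossingD[OF S _ _ o] by blast
  then show "X = Y" using 1 h noncrossingD[OF _ _ _ o m] by blast
qed

lemma Union_sat_ncp:
  assumes S: "S \<in> sat_ncp b U" and h: "\<And>V. V \<in> S \<Longrightarrow> h V \<in> sat_ncp b V"
  shows "\<Union>(h ` S) \<in> sat_ncp b U"
proof -
  have "\<Union>(h ` S) \<in> ncp U"
    using assms by (intro Union_ncp) (auto simp: sat_ncp_def)
  moreover have "saturated b U X" if "V \<in> S" "X \<in> h V" for V X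
  proof -
    have "X \<subseteq> V" using h[OF \<open>V \<in> S\<close>] that ncp_subset by (auto simp: sat_ncp_def)
    then show ?thesis using S h[OF \<open>V \<in> S\<close>] that by (auto simp: sat_ncp_def saturated_def)
  qed
  ultimately show ?thesis by (auto simp: sat_ncp_def)
qed

text \<open>This \<open>S\<close> is the join of \<open>P\<close> with the partition into fibres of
  \<open>b\<close>, and \<open>P\<close> is connected on each of its blocks. For uniqueness,
  connectedness on a block of one candidate keeps any other candidate from cutting that block, so
  two candidates refine each other.\<close>

lemma ex1_connected_join:
  assumes fin: "finite U" and ne: "U \<noteq> {}" and P: "P \<in> ncp U"
  shows "\<exists>!S. S \<in> sat_ncp b U \<and> finer P S \<and> (\<forall>V\<in>S. {B \<in> P. B \<subseteq> V} \<in> conn_ncp b V)"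
proof -
  \<comment> \<open>A partition \<open>S\<close> in \<open>Q\<close> with the most blocks works: a block on which \<open>P\<close> were not connected could be split.\<close>
  define Q where "Q = {S \<in> sat_ncp b U. finer P S}"
  have finQ: "finite Q"
    by (rule finite_subset[OF _ finite_ncp[OF fin]]) (auto simp: Q_def sat_ncp_def)
  have "{U} \<in> Q" using single_block_in_sat_ncp[OF ne] ncp_subset[OF P]
    by (auto simp: Q_def finer_def)
  then have "card ` Q \<noteq> {}" by blast
  then have "Max (card ` Q) \<in> card ` Q" using finQ by (intro Max_in) auto
  then obtain S where S: "S \<in> Q" and max: "\<And>T. T \<in> Q \<Longrightarrow> card T \<le> card S"
    using finQ by (metis (no_types, lifting) Max_ge finite_imageI imageE imageI)
  have Sn: "S \<in> ncp U" and SP: "finer P S" and Ss: "S \<in> sat_ncp b U"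
    using S by (auto simp: Q_def sat_ncp_def)
  have "{B \<in> P. B \<subseteq> V} \<in> conn_ncp b V" if V: "V \<in> S" for V
  proof -
    have "T = {V}" if T: "T \<in> sat_ncp b V" "finer {B \<in> P. B \<subseteq> V} T" for T
    proof (rule ccontr)
      assume TV: "T \<noteq> {V}"
      have Tn: "T \<in> ncp V" using T by (simp add: sat_ncp_def)
      have Vne: "V \<noteq> {}" and VU: "V \<subseteq> U" using V Sn ncp_nonempty ncp_subset by blast+
      define S' where "S' = \<Union>((\<lambda>W. if W = V then T else {W}) ` S)"
      have S'eq: "S' = (S - {V}) \<union> T" using V by (auto simp: S'_def)
      have "S' \<in> sat_ncp b U"
        unfolding S'_def
        using T single_block_in_sat_ncp ncp_nonempty[OF Sn] by (intro Union_sat_ncp[OF Ss]) auto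
      moreover have "finer P S'"
        unfolding finer_def
      proof
        fix B assume B: "B \<in> P"
        then obtain W where W: "W \<in> S" "B \<subseteq> W" using SP by (auto simp: finer_def)
        show "\<exists>V\<in>S'. B \<subseteq> V"
        proof (cases "W = V")
          case True
          then obtain X where "X \<in> T" "B \<subseteq> X" using T(2) B W by (auto simp: finer_def)
          then show ?thesis by (auto simp: S'eq)
        qed (use W S'eq in auto)
      qed
      ultimately have le: "card S' \<le> card S" using max by (simp add: Q_def)
      have disj: "(S - {V}) \<inter> T = {}"
      proof (rule ccontr)
        assume "(S - {V}) \<inter> T \<noteq> {}"
        then obtain X where X: "X \<in> S" "X \<noteq> V" "X \<in> T" by blast
        then obtain x where "x \<in> X" using ncp_nonempty[OF Tn] by blast
        then show False using X V ncp_block_unique[OF Sn] ncp_subset[OF Tn] by blast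
      qed
      have finS: "finite S" and finT: "finite T"
        using finite_ncp_elem[OF fin Sn] finite_ncp_elem[OF finite_subset[OF VU fin] Tn] by auto
      have "card S' = card S - 1 + card T"
        unfolding S'eq using disj finS finT V by (simp add: card_Un_disjoint)
      moreover have "card S \<ge> 1" using V finS by (metis One_nat_def Suc_leI card_gt_0_iff empty_iff)
      ultimately have "card T \<le> 1" using le by linarith
      then consider "T = {}" | X where "T = {X}"
        using finT by (metis card_0_eq card_1_singletonE le_neq_implies_less less_one)
      then show False
      proof cases
        case 1 then show ?thesis using Tn Vne by (auto simp: ncp_def partition_on_def)
      next
        case 2
        then have "X = V" using Tn by (auto simp: ncp_def partition_on_def)
        then show ?thesis using 2 TV by simp
      qed
    qed
    then show ?thesis using restrict_ncp[OF P Sn SP V] by (auto simp: conn_ncp_def)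
  qed
  then have ex: "S \<in> sat_ncp b U \<and> finer P S \<and> (\<forall>V\<in>S. {B \<in> P. B \<subseteq> V} \<in> conn_ncp b V)"
    using Ss SP by blast
  have sub: "\<exists>W\<in>S2. V \<subseteq> W"
    if 1: "S1 \<in> sat_ncp b U" "finer P S1" "\<forall>V\<in>S1. {B \<in> P. B \<subseteq> V} \<in> conn_ncp b V"
      and 2: "S2 \<in> sat_ncp b U" "finer P S2" and V: "V \<in> S1" for S1 S2 V
  proof -
    have n1: "S1 \<in> ncp U" and n2: "S2 \<in> ncp U" using 1 2 by (auto simp: sat_ncp_def)
    have VU: "V \<subseteq> U" "V \<noteq> {}" using V n1 ncp_subset ncp_nonempty by blast+
    \<comment> \<open>The nonempty traces of \<open>S2\<close> on \<open>V\<close> are saturated in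
      \<open>V\<close> and coarser than \<open>P\<close> there. Connectedness then forces
      \<open>T = {V}\<close>, so \<open>V\<close> lies in one block of \<open>S2\<close>.\<close>
    define T where "T = ((\<inter>) V ` S2) - {{}}"
    have "T \<in> ncp V"
    proof (rule ncpI)
      have "\<exists>W\<in>S2. x \<in> W" if "x \<in> V" for x using that VU ncp_cover[OF n2] by blast
      then show "\<Union>T = V" 
      proof (intro equalityI subsetI)
        fix x assume x: "x \<in> V"
        then obtain W where "W \<in> S2" "x \<in> W" using \<open>\<And>x. x \<in> V \<Longrightarrow> \<exists>W\<in>S2. x \<in> W\<close> by blast
        then have "V \<inter> W \<in> T" "x \<in> V \<inter> W" using x by (auto simp: T_def)
        then show "x \<in> \<Union>T" by blast
      qed (auto simp: T_def)
      show "{} \<notin> T" by (simp add: T_def)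
    next
      fix X Y x assume "X \<in> T" "Y \<in> T" and x: "x \<in> X" "x \<in> Y"
      then obtain X' Y' where 3: "X' \<in> S2" "Y' \<in> S2" "X = V \<inter> X'" "Y = V \<inter> Y'" by (auto simp: T_def)
      then show "X = Y" using ncp_block_unique[OF n2, of X' Y' x] x by simp
    next
      fix X Y x y z w assume "X \<in> T" "Y \<in> T" and o: "x < y" "y < z" "z < w"
        and m: "x \<in> X" "z \<in> X" "y \<in> Y" "w \<in> Y"
      then obtain X' Y' where 3: "X' \<in> S2" "Y' \<in> S2" "X = V \<inter> X'" "Y = V \<inter> Y'" by (auto simp: T_def)
      then show "X = Y" using noncrossingD[OF n2 3(1,2) o] m by simp
    qed
    moreover have "\<forall>X\<in>T. saturated b V X"
    proof
      fix X assume "X \<in> T"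
      then obtain W where W: "W \<in> S2" "X = V \<inter> W" by (auto simp: T_def)
      then have "saturated b U W" using 2(1) by (auto simp: sat_ncp_def)
      then show "saturated b V X" using W VU(1) unfolding saturated_def by blast
    qed
    ultimately have "T \<in> sat_ncp b V" by (simp add: sat_ncp_def)
    moreover have "finer {B \<in> P. B \<subseteq> V} T"
      unfolding finer_def
    proof
      fix B assume B: "B \<in> {B \<in> P. B \<subseteq> V}"
      then obtain W where W: "W \<in> S2" "B \<subseteq> W" using 2 by (auto simp: finer_def)
      have "B \<noteq> {}" using B ncp_nonempty[OF P] by blast
      then have "V \<inter> W \<in> T" using B W by (auto simp: T_def)
      then show "\<exists>V\<in>T. B \<subseteq> V" using B W by blast
    qed
    ultimately have "T = {V}" using 1(3) V by (auto simp: conn_ncp_def)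
    then have "V \<in> T" by simp
    then show ?thesis by (auto simp: T_def)
  qed
  show ?thesis
  proof (rule ex1I, rule ex)
    fix S' assume S': "S' \<in> sat_ncp b U \<and> finer P S' \<and> (\<forall>V\<in>S'. {B \<in> P. B \<subseteq> V} \<in> conn_ncp b V)"
    have "partition_on U S" "partition_on U S'" using ex S' by (auto simp: sat_ncp_def ncp_def)
    then have "refines U S S'" "refines U S' S"
      using sub[of S S'] sub[of S' S] ex S' by (auto simp: refines_def)
    then show "S' = S" using refines_asym by blast
  qed
qed

text \<open>When \<open>f\<close> gives the cumulants of the factors, this is the right-hand side of
  the formula for cumulants with products as arguments.\<close>

definition conn_sum :: "(nat \<Rightarrow> nat) \<Rightarrow> (nat set \<Rightarrow> complex) \<Rightarrow> nat set \<Rightarrow> complex" where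
  "conn_sum b f U = (\<Sum>P\<in>conn_ncp b U. prod f P)"

lemma conn_ncp_subset: "conn_ncp b U \<subseteq> ncp U"
  by (auto simp: conn_ncp_def)

text \<open>Distributing the product chooses one connected partition on every block of
  \<open>S\<close>. Gluing these choices is inverse to restricting \<open>P\<close> to the blocks of
  \<open>S\<close>.\<close>

lemma prod_conn_sum:
  assumes fin: "finite U" and S: "S \<in> ncp U"
  shows "(\<Prod>V\<in>S. conn_sum b f V) =
    (\<Sum>P | P \<in> ncp U \<and> finer P S \<and> (\<forall>V\<in>S. {B \<in> P. B \<subseteq> V} \<in> conn_ncp b V). prod f P)"
proof -
  have finS: "finite S" using finite_ncp_elem[OF fin S] .
  have finV: "finite V" if "V \<in> S" for V using that fin ncp_subset[OF S] finite_subset by blast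
  \<comment> \<open>Restriction undoes gluing: a piece of \<open>h W\<close> inside \<open>V\<close>
    is nonempty, so \<open>W\<close> and \<open>V\<close> meet and are equal.\<close>
  have rest: "{B \<in> \<Union>(h ` S). B \<subseteq> V} = h V"
    if h: "\<forall>V\<in>S. h V \<in> ncp V" and V: "V \<in> S" for h V
  proof -
    have "B \<in> h V" if B: "B \<in> h W" "W \<in> S" "B \<subseteq> V" for B W
    proof -
      obtain x where "x \<in> B" using h B ncp_nonempty by blast
      then have "W = V" using B V ncp_block_unique[OF S] h ncp_subset by blast
      then show ?thesis using B by simp
    qed
    then show ?thesis using V h ncp_subset by blast
  qed
  have "(\<Prod>V\<in>S. conn_sum b f V) = (\<Sum>h\<in>PiE S (conn_ncp b). \<Prod>V\<in>S. prod f (h V))"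
    unfolding conn_sum_def
    by (rule prod_sum_PiE[OF finS])
      (rule finite_subset[OF conn_ncp_subset finite_ncp[OF finV]])
  also have "\<dots> = (\<Sum>P | P \<in> ncp U \<and> finer P S \<and> (\<forall>V\<in>S. {B \<in> P. B \<subseteq> V} \<in> conn_ncp b V). prod f P)"
  proof (rule sum.reindex_bij_witness[where j = "\<lambda>h. \<Union>(h ` S)"
        and i = "\<lambda>P. restrict (\<lambda>V. {B \<in> P. B \<subseteq> V}) S"])
    fix h assume h: "h \<in> PiE S (conn_ncp b)"
    then have hn: "\<forall>V\<in>S. h V \<in> ncp V" using conn_ncp_subset by blast
    note r = rest[OF hn]
    show "restrict (\<lambda>V. {B \<in> \<Union>(h ` S). B \<subseteq> V}) S = h"
    proof (rule ext)
      fix V show "restrict (\<lambda>V. {B \<in> \<Union>(h ` S). B \<subseteq> V}) S V = h V"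
        using r[of V] h by (cases "V \<in> S") (auto simp: PiE_def extensional_def)
    qed
    show "\<Union>(h ` S) \<in> {P \<in> ncp U. finer P S \<and> (\<forall>V\<in>S. {B \<in> P. B \<subseteq> V} \<in> conn_ncp b V)}"
    proof (intro CollectI conjI)
      show "\<Union>(h ` S) \<in> ncp U" using Union_ncp[OF S] hn by blast
      have "B \<subseteq> V" if "V \<in> S" "B \<in> h V" for V B using hn ncp_subset that by blast
      then show "finer (\<Union>(h ` S)) S" by (auto simp: finer_def)
      show "\<forall>V\<in>S. {B \<in> \<Union>(h ` S). B \<subseteq> V} \<in> conn_ncp b V" using r h by (simp add: PiE_mem)
    qed
    have "prod f (\<Union>(h ` S)) = (\<Prod>V\<in>S. prod f (h V))"
    proof (rule prod.UNION_disjoint[OF finS])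
      show "\<forall>V\<in>S. finite (h V)" using hn finV finite_ncp_elem by blast
      show "\<forall>V\<in>S. \<forall>W\<in>S. V \<noteq> W \<longrightarrow> h V \<inter> h W = {}"
      proof (intro ballI impI)
        fix V W assume VW: "V \<in> S" "W \<in> S" "V \<noteq> W"
        have False if B: "B \<in> h V" "B \<in> h W" for B
        proof -
          obtain x where "x \<in> B" using hn VW B ncp_nonempty by blast
          then have "x \<in> V" "x \<in> W" using VW hn B ncp_subset by blast+
          then show False using VW ncp_block_unique[OF S] by blast
        qed
        then show "h V \<inter> h W = {}" by blast
      qed
    qed
    then show "prod f (\<Union>(h ` S)) = (\<Prod>V\<in>S. prod f (h V))" .
  next
    fix P assume P: "P \<in> {P \<in> ncp U. finer P S \<and> (\<forall>V\<in>S. {B \<in> P. B \<subseteq> V} \<in> conn_ncp b V)}"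
    then show "\<Union>(restrict (\<lambda>V. {B \<in> P. B \<subseteq> V}) S ` S) = P"
      by (auto simp: finer_def)
    show "restrict (\<lambda>V. {B \<in> P. B \<subseteq> V}) S \<in> PiE S (conn_ncp b)"
      using P by auto
  qed
  finally show ?thesis .
qed

text \<open>The partitions \<open>P\<close> are grouped by their join with the fibres of
  \<open>b\<close>, which \<open>ex1_connected_join\<close> makes unique.\<close>

lemma sum_ncp_eq_sum_sat_ncp:
  assumes fin: "finite U" and ne: "U \<noteq> {}"
  shows "(\<Sum>P\<in>ncp U. prod f P) = (\<Sum>S\<in>sat_ncp b U. \<Prod>V\<in>S. conn_sum b f V)"
proof -
  define R where "R S P \<longleftrightarrow> finer P S \<and> (\<forall>V\<in>S. {B \<in> P. B \<subseteq> V} \<in> conn_ncp b V)" for S P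
  have finS: "finite (sat_ncp b U)"
    by (rule finite_subset[OF _ finite_ncp[OF fin]]) (auto simp: sat_ncp_def)
  have ex1: "\<exists>!S. S \<in> sat_ncp b U \<and> R S P" if "P \<in> ncp U" for P
    using ex1_connected_join[OF fin ne that] by (simp add: R_def)
  have one: "(\<Sum>S\<in>sat_ncp b U. if R S P then prod f P else 0) = prod f P" if P: "P \<in> ncp U" for P
  proof -
    obtain S where "S \<in> sat_ncp b U" "R S P" "\<And>T. T \<in> sat_ncp b U \<Longrightarrow> R T P \<Longrightarrow> T = S"
      using ex1[OF P] by blast
    then have "{T \<in> sat_ncp b U. R T P} = {S}" by blast
    then show ?thesis by (simp add: sum.inter_filter[OF finS, symmetric])
  qed
  have "(\<Sum>S\<in>sat_ncp b U. \<Prod>V\<in>S. conn_sum b f V) =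
      (\<Sum>S\<in>sat_ncp b U. \<Sum>P | P \<in> ncp U \<and> R S P. prod f P)"
    using prod_conn_sum[OF fin] by (intro sum.cong) (auto simp: sat_ncp_def R_def)
  also have "\<dots> = (\<Sum>S\<in>sat_ncp b U. \<Sum>P\<in>ncp U. if R S P then prod f P else 0)"
    by (simp add: sum.inter_filter[OF finite_ncp[OF fin]])
  also have "\<dots> = (\<Sum>P\<in>ncp U. \<Sum>S\<in>sat_ncp b U. if R S P then prod f P else 0)"
    by (rule sum.swap)
  also have "\<dots> = (\<Sum>P\<in>ncp U. prod f P)" using one by simp
  finally show ?thesis by simp
qed

lemma sum_sat_ncp_transport:
  assumes mono: "mono_on U b" and onto: "b ` U = W"
  shows "(\<Sum>S\<in>sat_ncp b U. prod f S) = (\<Sum>P\<in>ncp W. \<Prod>V\<in>P. f (b -` V \<inter> U))"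
proof -
  have inj: "inj_on (\<lambda>V. b -` V \<inter> U) P" if "P \<in> ncp W" for P
    using ncp_subset[OF that] onto by (intro inj_onI) blast
  show ?thesis
    unfolding sum.reindex_bij_betw[OF bij_betw_ncp_sat_ncp[OF assms], symmetric]
    by (intro sum.cong refl) (simp add: prod.reindex[OF inj] o_def)
qed

text \<open>Moments determine cumulants. The one-block partition isolates \<open>f U\<close>, and
  all other partitions have only proper subsets of \<open>U\<close> as blocks, where induction
  applies.\<close>

lemma moment_inversion:
  assumes "finite U" "U \<noteq> {}"
    and "\<And>W. W \<subseteq> U \<Longrightarrow> W \<noteq> {} \<Longrightarrow> (\<Sum>P\<in>ncp W. prod f P) = (\<Sum>P\<in>ncp W. prod g P)"
  shows "f U = (g U :: complex)"
  using assms
proof (induction "card U" arbitrary: U rule: less_induct)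
  case less
  have eq: "prod f P = prod g P" if P: "P \<in> ncp U - {{U}}" for P
  proof (rule prod.cong[OF refl])
    fix V assume V: "V \<in> P"
    then have "V \<subset> U" "V \<noteq> {}"
      using P ncp_subset[of P U V] ncp_nonempty[of P U V] ncp_eq_single_block[of P U] by auto
    then show "f V = g V"
      using less.prems by (intro less.hyps) (auto simp: psubset_card_mono intro: finite_subset)
  qed
  have split: "(\<Sum>P\<in>ncp U. prod h P) = h U + (\<Sum>P\<in>ncp U - {{U}}. prod h P)" for h :: "nat set \<Rightarrow> complex"
    using sum.remove[OF finite_ncp[OF less.prems(1)] single_block_in_ncp[OF less.prems(2)], of "prod h"]
    by simp
  have "(\<Sum>P\<in>ncp U - {{U}}. prod f P) = (\<Sum>P\<in>ncp U - {{U}}. prod g P)"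
    using eq by (intro sum.cong) auto
  then show ?case using less.prems(3)[OF subset_refl less.prems(2)] split by simp
qed

section \<open>Cumulants with products as arguments\<close>

text \<open>The number, counted from 0, of the interval that contains \<open>x\<close>. Positions
  beyond the last interval get \<open>length ps\<close>, which keeps the function monotone on all
  naturals.\<close>

fun block_index :: "nat list \<Rightarrow> nat \<Rightarrow> nat" where
  "block_index [] x = 0"
| "block_index (p # ps) x = (if x < p then 0 else Suc (block_index ps (x - p)))"

lemma block_index_mono: "x \<le> y \<Longrightarrow> block_index ps x \<le> block_index ps y"
  by (induction ps arbitrary: x y) (auto simp: diff_le_mono)

lemma block_index_eq_iff:
  assumes "x < sum_list ps" "k < length ps"
  shows "block_index ps x = k \<longleftrightarrow> sum_list (take k ps) \<le> x \<and> x < sum_list (take (Suc k) ps)"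
  using assms
proof (induction ps arbitrary: x k)
  case (Cons p ps)
  show ?case
  proof (cases "x < p")
    case True
    then show ?thesis by (cases k) auto
  next
    case False
    then have "x - p < sum_list ps" using Cons.prems by auto
    then show ?thesis using False Cons by (cases k) auto
  qed
qed simp

lemma block_index_less: "x < sum_list ps \<Longrightarrow> block_index ps x < length ps"
  by (induction ps arbitrary: x) auto

lemma block_index_onto:
  assumes "\<forall>p\<in>set ps. p \<ge> 1"
  shows "block_index ps ` {..<sum_list ps} = {..<length ps}"
proof (intro equalityI subsetI)
  fix k assume k: "k \<in> {..<length ps}"
  have "sum_list (take (Suc k) ps) = sum_list (take k ps) + ps ! k"
    using k by (simp add: take_Suc_conv_app_nth)
  moreover have "ps ! k \<ge> 1" using k assms by auto
  moreover have "sum_list ps = sum_list (take (Suc k) ps) + sum_list (drop (Suc k) ps)"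
    by (metis append_take_drop_id sum_list_append)
  ultimately have "block_index ps (sum_list (take k ps)) = k" "sum_list (take k ps) < sum_list ps"
    using block_index_eq_iff[of "sum_list (take k ps)" ps k] k by auto
  then show "k \<in> block_index ps ` {..<sum_list ps}" by force
qed (use block_index_less in auto)

lemma interval_partition_eq_fibres:
  "interval_partition ps = (\<lambda>k. block_index ps -` {k} \<inter> {..<sum_list ps}) ` {..<length ps}"
  unfolding interval_partition_def
proof (rule image_cong[OF refl])
  fix k assume k: "k \<in> {..<length ps}"
  have "sum_list (take (Suc k) ps) + sum_list (drop (Suc k) ps) = sum_list ps"
    by (metis append_take_drop_id sum_list_append)
  then have le: "sum_list (take (Suc k) ps) \<le> sum_list ps" by linarith
  show "{sum_list (take k ps)..<sum_list (take (Suc k) ps)} =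
      block_index ps -` {k} \<inter> {..<sum_list ps}"
  proof (rule set_eqI)
    fix x
    show "x \<in> {sum_list (take k ps)..<sum_list (take (Suc k) ps)} \<longleftrightarrow>
        x \<in> block_index ps -` {k} \<inter> {..<sum_list ps}"
      using block_index_eq_iff[of x ps k] k le by (cases "x < sum_list ps") auto
  qed
qed

text \<open>This lets a moment of selected products be read as a moment of all the factors in the
  corresponding intervals.\<close>

lemma nths_concat:
  "nths (concat xss) (block_index (map length xss) -` W \<inter> {..<length (concat xss)}) =
    concat (nths xss W)"
proof (induction xss arbitrary: W)
  case (Cons xs xss)
  define S where "S = block_index (map length (xs # xss)) -` W \<inter> {..<length (concat (xs # xss))}"
  have "nths xs S = (if 0 \<in> W then xs else [])"
  proof (cases "0 \<in> W")
    case True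
    then show ?thesis by (auto intro!: nths_all simp: S_def)
  next
    case False
    then have "set (nths xs S) = {}" by (auto simp: set_nths S_def)
    then show ?thesis using False by simp
  qed
  moreover have "{j. j + length xs \<in> S} =
      block_index (map length xss) -` {k. Suc k \<in> W} \<inter> {..<length (concat xss)}"
    by (auto simp: S_def)
  ultimately have "nths (concat (xs # xss)) S = concat (nths (xs # xss) W)"
    using Cons.IH[of "{k. Suc k \<in> W}"] by (simp add: nths_append nths_Cons)
  then show ?case by (simp only: S_def)
qed simp

lemma prod_list_concat: "prod_list (concat xss) = prod_list (map prod_list xss)"
  by (induction xss) auto

text \<open>The moment-cumulant relation is given for initial segments only. The rank function
  \<open>b\<close> carries it over to \<open>W\<close>, and it is the same renumbering that nested
  uses of \<open>nths\<close> produce.\<close>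

lemma moment_nths:
  assumes fc: "free_cumulants smul \<phi> \<kappa>" and W: "W \<subseteq> {..<length xs}" "W \<noteq> {}"
  shows "\<phi> (prod_list (nths xs W)) = (\<Sum>P\<in>ncp W. \<Prod>V\<in>P. \<kappa> (nths xs V))"
proof -
  have finW: "finite W" using W(1) finite_subset by blast
  define b where "b x = card {y \<in> W. y < x}" for x
  have less: "b x < b y" if "x < y" "x \<in> W" "y \<in> W" for x y
    unfolding b_def using that finW by (intro psubset_card_mono) auto
  have inj: "inj_on b W"
    using less by (metis inj_onI less_irrefl nat_neq_iff)
  have mono: "mono_on W b"
    unfolding mono_on_def using less by (metis le_eq_less_or_eq)
  have sub: "b ` W \<subseteq> {..<card W}"
    unfolding b_def using finW by (auto intro!: psubset_card_mono)
  have "card (b ` W) = card W" using inj by (rule card_image)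
  then have onto: "b ` W = {..<card W}"
    using sub by (intro card_subset_eq) auto
  \<comment> \<open>The fibres of the injective \<open>b\<close> are single points, so saturation is
    automatic.\<close>
  have "sat_ncp b W = ncp W"
    using inj ncp_subset by (fastforce simp: sat_ncp_def saturated_def inj_on_def)
  then have "(\<Sum>P\<in>ncp W. \<Prod>V\<in>P. \<kappa> (nths xs V)) =
      (\<Sum>P\<in>ncp {..<card W}. \<Prod>V\<in>P. \<kappa> (nths xs (b -` V \<inter> W)))"
    using sum_sat_ncp_transport[OF mono onto] by simp
  also have "\<dots> = (\<Sum>P\<in>NC (card W). block_prod \<kappa> P (nths xs W))"
  proof -
    have "nths (nths xs W) V = nths xs (b -` V \<inter> W)" for V
      unfolding nths_nths b_def by (rule arg_cong[of _ _ "nths xs"]) auto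
    then show ?thesis by (simp add: block_prod_def NC_eq_ncp)
  qed
  also have "card W = length (nths xs W)"
    using W(1) by (auto simp: length_nths intro!: arg_cong[of _ _ card])
  also have "(\<Sum>P\<in>NC (length (nths xs W)). block_prod \<kappa> P (nths xs W)) = \<phi> (prod_list (nths xs W))"
  proof -
    have "set (nths xs W) \<noteq> {}" using W by (auto simp: set_nths)
    then show ?thesis using fc by (simp add: free_cumulants_def)
  qed
  finally show ?thesis by simp
qed

text \<open>By \<open>moment_inversion\<close> it suffices that both sides yield the same moments
  for every nonempty set \<open>W\<close> of products. The moment of the factors is a sum over all
  noncrossing partitions; grouped by their joins with the intervals, these become sums of connected
  parts over the noncrossing partitions of \<open>W\<close>.\<close>

lemma cumulant_of_products:
  assumes fc: "free_cumulants smul \<phi> \<kappa>" and ne: "xss \<noteq> []" "[] \<notin> set xss"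
  shows "\<kappa> (map prod_list xss) =
    conn_sum (block_index (map length xss)) (\<lambda>B. \<kappa> (nths (concat xss) B)) {..<length (concat xss)}"
proof -
  define b where "b = block_index (map length xss)"
  define f where "f B = \<kappa> (nths (concat xss) B)" for B
  define U where "U = {..<length (concat xss)}"
  have onto: "b ` U = {..<length xss}"
    using block_index_onto[of "map length xss"] ne(2)
    by (auto simp: b_def U_def length_concat Suc_le_eq)
  have "\<kappa> (nths (map prod_list xss) {..<length xss}) = conn_sum b f (b -` {..<length xss} \<inter> U)"
  proof (rule moment_inversion[where f = "\<lambda>W. \<kappa> (nths (map prod_list xss) W)"
        and g = "\<lambda>W. conn_sum b f (b -` W \<inter> U)"])
    show "{..<length xss} \<noteq> {}" using ne by (auto simp: lessThan_empty_iff)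
    fix W assume W: "W \<subseteq> {..<length xss}" "W \<noteq> {}"
    \<comment> \<open>The positions of all factors that belong to the products selected by
      \<open>W\<close>.\<close>
    define W' where "W' = b -` W \<inter> U"
    have "x \<in> b ` W'" if "x \<in> W" for x
    proof -
      have "x \<in> b ` U" using W(1) onto that by auto
      then show ?thesis using that by (auto simp: W'_def)
    qed
    then have W': "b ` W' = W" "W' \<subseteq> U" by (auto simp: W'_def)
    then have W'_ne: "W' \<noteq> {}" using W by blast
    have "(\<Sum>P\<in>ncp W. \<Prod>V\<in>P. \<kappa> (nths (map prod_list xss) V)) =
        \<phi> (prod_list (nths (map prod_list xss) W))"
      using moment_nths[OF fc, of W "map prod_list xss"] W by simp
    also have "\<dots> = \<phi> (prod_list (nths (concat xss) W'))"
      using nths_concat[of xss W] by (simp add: W'_def b_def U_def prod_list_concat nths_map)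
    also have "\<dots> = (\<Sum>P\<in>ncp W'. prod f P)"
      using moment_nths[OF fc _ W'_ne, of "concat xss"] W' by (simp add: U_def f_def)
    also have "\<dots> = (\<Sum>S\<in>sat_ncp b W'. \<Prod>V\<in>S. conn_sum b f V)"
      using W'_ne W'(2) by (intro sum_ncp_eq_sum_sat_ncp) (auto simp: U_def intro: finite_subset)
    also have "\<dots> = (\<Sum>P\<in>ncp W. \<Prod>V\<in>P. conn_sum b f (b -` V \<inter> W'))"
      using W'(1) block_index_mono by (intro sum_sat_ncp_transport) (auto simp: mono_on_def b_def)
    \<comment> \<open>The ground set must not depend on \<open>W\<close>, since
      \<open>moment_inversion\<close> compares two fixed set functions.\<close>
    also have "\<dots> = (\<Sum>P\<in>ncp W. \<Prod>V\<in>P. conn_sum b f (b -` V \<inter> U))"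
    proof (intro sum.cong prod.cong refl)
      fix P V assume "P \<in> ncp W" "V \<in> P"
      then have "V \<subseteq> W" using ncp_subset by blast
      then have "b -` V \<inter> W' = b -` V \<inter> U" by (auto simp: W'_def)
      then show "conn_sum b f (b -` V \<inter> W') = conn_sum b f (b -` V \<inter> U)" by simp
    qed
    finally show "(\<Sum>P\<in>ncp W. \<Prod>V\<in>P. \<kappa> (nths (map prod_list xss) V)) =
        (\<Sum>P\<in>ncp W. \<Prod>V\<in>P. conn_sum b f (b -` V \<inter> U))" .
  qed simp
  moreover have "b -` {..<length xss} \<inter> U = U" using onto by auto
  ultimately show ?thesis
    by (simp add: b_def f_def[abs_def] U_def nths_all)
qed

text \<open>The common upper bounds of \<open>P\<close> and the interval partition are the elements
  of \<open>sat_ncp\<close> coarser than \<open>P\<close>. Their least element is the one-block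
  partition exactly when there is no other common upper bound.\<close>

lemma NC_join_eq_single_block_iff:
  assumes ps: "\<forall>p\<in>set ps. p \<ge> 1" "ps \<noteq> []" and P: "P \<in> NC (sum_list ps)"
  shows "NC_join (sum_list ps) P (interval_partition ps) = {{..<sum_list ps}} \<longleftrightarrow>
    P \<in> conn_ncp (block_index ps) {..<sum_list ps}"
proof -
  define U where "U = {..<sum_list ps}"
  define b where "b = block_index ps"
  define R where "R = NC_join (sum_list ps) P (interval_partition ps)"
  have IP: "interval_partition ps \<in> NC (sum_list ps)"
    using ps(1) by (rule interval_partition_in_NC)
  have sat: "S \<in> sat_ncp b U \<longleftrightarrow> S \<in> NC (sum_list ps) \<and> refines U (interval_partition ps) S" for S
  proof (cases "S \<in> NC (sum_list ps)")
    case True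
    then have S: "S \<in> ncp U" by (simp add: NC_eq_ncp U_def)
    have "(\<forall>V\<in>S. saturated b U V) \<longleftrightarrow> finer (interval_partition ps) S"
    proof
      assume sat: "\<forall>V\<in>S. saturated b U V"
      show "finer (interval_partition ps) S"
        unfolding finer_def
      proof
        fix G assume G: "G \<in> interval_partition ps"
        then obtain k where k: "G = b -` {k} \<inter> U"
          by (auto simp: interval_partition_eq_fibres b_def U_def)
        have "G \<noteq> {}" using IP G by (auto simp: NC_def partition_on_def)
        then obtain x where x: "x \<in> G" by blast
        then obtain V where V: "V \<in> S" "x \<in> V" using ncp_cover[OF S, of x] k by blast
        then have "G \<subseteq> V" using sat x k by (auto simp: saturated_def)
        then show "\<exists>V\<in>S. G \<subseteq> V" using V by blast
      qed
    next
      assume fin: "finer (interval_partition ps) S"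
      show "\<forall>V\<in>S. saturated b U V"
        unfolding saturated_def
      proof (intro ballI impI)
        fix V x y assume V: "V \<in> S" "x \<in> V" and y: "y \<in> U" "b x = b y"
        have x: "x \<in> U" using V ncp_subset[OF S] by blast
        then have "b -` {b x} \<inter> U \<in> interval_partition ps"
          using block_index_less by (auto simp: interval_partition_eq_fibres b_def U_def)
        then obtain W where W: "W \<in> S" "b -` {b x} \<inter> U \<subseteq> W" using fin by (auto simp: finer_def)
        then have "x \<in> W" "y \<in> W" using x y by auto
        then show "y \<in> V" using ncp_block_unique[OF S V(1) W(1), of x] V by simp
      qed
    qed
    then show ?thesis
      using True S IP by (auto simp: sat_ncp_def refines_def finer_def NC_def U_def)
  qed (auto simp: sat_ncp_def NC_eq_ncp U_def)
  have join: "is_NC_join (sum_list ps) P (interval_partition ps) R"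
    unfolding R_def using P IP by (rule is_NC_join_NC_join)
  have Pn: "P \<in> ncp U" using P by (simp add: NC_eq_ncp U_def)
  have ref: "refines U P S \<longleftrightarrow> finer P S" if "S \<in> ncp U" for S
    using that Pn by (auto simp: refines_def finer_def ncp_def)
  have "R = {U} \<longleftrightarrow> P \<in> conn_ncp b U"
  proof
    assume R: "R = {U}"
    have "S = {U}" if S: "S \<in> sat_ncp b U" "finer P S" for S
    proof -
      have Sn: "S \<in> ncp U" using S by (simp add: sat_ncp_def)
      have "refines U R S"
        using join S sat[of S] ref[OF Sn] by (auto simp: is_NC_join_def U_def)
      then obtain V where V: "V \<in> S" "U \<subseteq> V" by (auto simp: refines_def R)
      then have "V = U" using ncp_subset[OF Sn] by blast
      then show ?thesis using ncp_eq_single_block[OF Sn] V by simp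
    qed
    then show "P \<in> conn_ncp b U" using Pn by (simp add: conn_ncp_def)
  next
    assume "P \<in> conn_ncp b U"
    moreover have "R \<in> sat_ncp b U" "finer P R"
      using join sat[of R] ref[of R] by (auto simp: is_NC_join_def U_def NC_eq_ncp)
    ultimately show "R = {U}" by (simp add: conn_ncp_def)
  qed
  then show ?thesis by (simp add: R_def U_def b_def)
qed

section \<open>Counting the solutions of the index equations\<close>

definition steps :: "'b list \<Rightarrow> ('b \<times> 'b) set" where
  "steps xs = set (zip xs (tl xs))"

text \<open>For a distinct list, the graph of the cyclic permutation of its entries. As a set of
  pairs it does not see where the cycle is cut open.\<close>

definition cyc_pairs :: "'b list \<Rightarrow> ('b \<times> 'b) set" where
  "cyc_pairs xs = set (zip xs (rotate1 xs))"

lemma steps_append: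
  "xs \<noteq> [] \<Longrightarrow> ys \<noteq> [] \<Longrightarrow> steps (xs @ ys) = steps xs \<union> {(last xs, hd ys)} \<union> steps ys"
proof (induction xs)
  case (Cons x xs)
  then show ?case by (cases xs; cases ys) (auto simp: steps_def)
qed simp

lemma steps_subset: "steps xs \<subseteq> set (butlast xs) \<times> set (tl xs)"
proof (induction xs)
  case (Cons x xs)
  then show ?case by (cases xs) (auto simp: steps_def)
qed (simp add: steps_def)

text \<open>A cycle is a path that returns to its first entry, which reduces the merging of cycles
  to concatenating paths.\<close>

lemma cyc_pairs_Cons: "cyc_pairs (x # xs) = steps (x # xs @ [x])"
proof -
  have "zip (x # xs) (xs @ [x]) = zip (x # xs @ [x]) (xs @ [x])"
    using zip_append1[of "x # xs" "[x]" "xs @ [x]"] by simp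
  then show ?thesis by (simp add: cyc_pairs_def steps_def)
qed

lemma cyc_pairs_rotate1: "cyc_pairs (rotate1 xs) = cyc_pairs xs"
proof (cases xs)
  case (Cons x ys)
  show ?thesis
  proof (cases ys)
    case (Cons a zs)
    have "zip (ys @ [x]) ((zs @ [x]) @ [a]) = zip ys (zs @ [x]) @ [(x, a)]"
      using Cons by (subst zip_append) auto
    then show ?thesis using \<open>xs = x # ys\<close> Cons by (auto simp: cyc_pairs_def)
  qed (use \<open>xs = x # ys\<close> in simp)
qed simp

lemma cyc_pairs_rotate: "cyc_pairs (xs @ ys) = cyc_pairs (ys @ xs)"
proof (induction xs arbitrary: ys)
  case (Cons x xs)
  have "cyc_pairs ((x # xs) @ ys) = cyc_pairs (xs @ ys @ [x])"
    using cyc_pairs_rotate1[of "(x # xs) @ ys"] by simp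
  also have "\<dots> = cyc_pairs (ys @ x # xs)" using Cons.IH[of "ys @ [x]"] by simp
  finally show ?case .
qed simp

text \<open>
  In terms of permutations: the product of two disjoint cycles with the transposition of \<open>u\<close> and \<open>v\<close>
  is the merged cycle.
\<close>

lemma cyc_pairs_merge:
  assumes "distinct (v # z # T @ X)"
  obtains w u F where
    "cyc_pairs (v # X) \<union> cyc_pairs (z # T) = F \<union> {(v, w), (u, z)}"
    "cyc_pairs (v # z # T @ X) = F \<union> {(v, z), (u, w)}"
    "w \<in> insert v (set X)" "u \<in> insert z (set T)"
    "F \<subseteq> (set X \<union> insert z (set T)) \<times> (insert v (set X) \<union> set T)"
proof -
  \<comment> \<open>\<open>w\<close> is the successor of \<open>v\<close> in the first cycle and
    \<open>u\<close> the predecessor of \<open>z\<close> in the second. For empty \<open>X\<close>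
    or \<open>T\<close> they are \<open>v\<close> and \<open>z\<close> themselves, hence the padded
    lists.\<close>
  define w where "w = hd (X @ [v])"
  define u where "u = last (z # T)"
  define F where "F = steps (X @ [v]) \<union> steps (z # T)"
  have single: "steps [x] = {}" for x :: 'a by (simp add: steps_def)
  have "cyc_pairs (v # X) = {(v, w)} \<union> steps (X @ [v])"
    using steps_append[of "[v]" "X @ [v]"] by (simp add: cyc_pairs_Cons w_def single)
  moreover have "cyc_pairs (z # T) = steps (z # T) \<union> {(u, z)}"
    using steps_append[of "z # T" "[z]"] by (simp add: cyc_pairs_Cons u_def single)
  moreover have "cyc_pairs (v # z # T @ X) = {(v, z)} \<union> (steps (z # T) \<union> {(u, w)} \<union> steps (X @ [v]))"
    using steps_append[of "[v]" "(z # T) @ X @ [v]"] steps_append[of "z # T" "X @ [v]"]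
    by (simp add: cyc_pairs_Cons u_def w_def single last_ConsL insert_commute del: last.simps)
  moreover have "w \<in> insert v (set X)" by (cases X) (auto simp: w_def)
  moreover have "u \<in> insert z (set T)" using last_in_set[of "z # T"] by (simp add: u_def del: last.simps)
  \<comment> \<open>With distinctness this says that no pair of \<open>F\<close> starts at
    \<open>v\<close> or ends at \<open>z\<close>.\<close>
  moreover have "F \<subseteq> (set X \<union> insert z (set T)) \<times> (insert v (set X) \<union> set T)"
  proof -
    have "set (butlast (z # T)) \<subseteq> insert z (set T)" by (auto dest: in_set_butlastD)
    moreover have "set (tl (X @ [v])) \<subseteq> insert v (set X)" by (cases X) auto
    ultimately show ?thesis
      using steps_subset[of "X @ [v]"] steps_subset[of "z # T"]
      unfolding F_def by (auto simp del: butlast.simps)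
  qed
  ultimately show thesis by (intro that[of F w u]) (auto simp: F_def)
qed

section \<open>Merging two blocks at neighbouring points\<close>

lemma sorted_list_of_set_Un:
  fixes A B :: "nat set"
  assumes "finite A" "finite B" "\<And>a b. a \<in> A \<Longrightarrow> b \<in> B \<Longrightarrow> a < b"
  shows "sorted_list_of_set (A \<union> B) = sorted_list_of_set A @ sorted_list_of_set B"
proof (rule sorted_distinct_set_unique)
  show "sorted (sorted_list_of_set A @ sorted_list_of_set B)"
    using assms by (auto simp: sorted_append less_imp_le)
  have "A \<inter> B = {}" using assms(3) by blast
  then show "distinct (sorted_list_of_set A @ sorted_list_of_set B)"
    using assms by simp
qed (use assms in auto)

text \<open>No point of \<open>W\<close> fits between the neighbours \<open>e\<close> and
  \<open>f\<close>. So if \<open>W\<close> crossed the union using points of both blocks, replacing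
  one of the four points by \<open>e\<close> or \<open>f\<close> would give a crossing of
  \<open>W\<close> with \<open>B\<close> or \<open>C\<close> alone. Either order of \<open>e\<close>
  and \<open>f\<close> is allowed so that the roles of \<open>B\<close> and \<open>C\<close> can be
  exchanged.\<close>

lemma merge_no_crossing:
  assumes P: "P \<in> ncp U" "B \<in> P" "C \<in> P" "W \<in> P" "W \<noteq> B" "W \<noteq> C"
    and e: "e \<in> B" "f \<in> C" "e = Suc f \<or> f = Suc e"
    and o: "x < y" "y < z" "z < w"
  shows "\<not> (x \<in> B \<and> z \<in> C \<and> y \<in> W \<and> w \<in> W)" "\<not> (x \<in> W \<and> z \<in> W \<and> y \<in> B \<and> w \<in> C)"
proof -
  have noB: "\<not> (a1 < a2 \<and> a2 < a3 \<and> a3 < a4 \<and> a1 \<in> B \<and> a3 \<in> B \<and> a2 \<in> W \<and> a4 \<in> W)" for a1 a2 a3 a4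
    using noncrossingD[OF P(1) P(2) P(4), of a1 a2 a3 a4] P(5,6) by metis
  have noB': "\<not> (a1 < a2 \<and> a2 < a3 \<and> a3 < a4 \<and> a1 \<in> W \<and> a3 \<in> W \<and> a2 \<in> B \<and> a4 \<in> B)" for a1 a2 a3 a4
    using noncrossingD[OF P(1) P(4) P(2), of a1 a2 a3 a4] P(5,6) by metis
  have noC: "\<not> (a1 < a2 \<and> a2 < a3 \<and> a3 < a4 \<and> a1 \<in> C \<and> a3 \<in> C \<and> a2 \<in> W \<and> a4 \<in> W)" for a1 a2 a3 a4
    using noncrossingD[OF P(1) P(3) P(4), of a1 a2 a3 a4] P(5,6) by metis
  have noC': "\<not> (a1 < a2 \<and> a2 < a3 \<and> a3 < a4 \<and> a1 \<in> W \<and> a3 \<in> W \<and> a2 \<in> C \<and> a4 \<in> C)" for a1 a2 a3 a4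
    using noncrossingD[OF P(1) P(4) P(3), of a1 a2 a3 a4] P(5,6) by metis
  have ne: "a \<noteq> e" "a \<noteq> f" if "a \<in> W" for a
    using ncp_block_unique[OF P(1,4,2) that] ncp_block_unique[OF P(1,4,3) that] P(5,6) e by auto
  show "\<not> (x \<in> B \<and> z \<in> C \<and> y \<in> W \<and> w \<in> W)"
  proof
    assume m: "x \<in> B \<and> z \<in> C \<and> y \<in> W \<and> w \<in> W"
    show False
    proof (cases "f < y")
      case True
      then show False using noC[of f y z w] m o e by blast
    next
      case False
      \<comment> \<open>As \<open>y\<close> is neither of the two neighbours, it lies on the same
        side of both.\<close>
      then have "y < e" "y < f" using ne[of y] m e(3) by auto
      show False
      proof (cases "e < w")
        case True
        then show False using noB[of x y e w] m o e \<open>y < e\<close> by blast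
      next
        case False
        then have "w < f" using ne[of w] m e(3) by auto
        then show False using noC'[of y z w f] m o e by blast
      qed
    qed
  qed
  show "\<not> (x \<in> W \<and> z \<in> W \<and> y \<in> B \<and> w \<in> C)"
  proof
    assume m: "x \<in> W \<and> z \<in> W \<and> y \<in> B \<and> w \<in> C"
    show False
    proof (cases "z < e")
      case True
      then show False using noB'[of x y z e] m o e by blast
    next
      case False
      then have "f < z" using ne[of z] m e(3) by auto
      show False
      proof (cases "x < f")
        case True
        then show False using noC'[of x f z w] m o e \<open>f < z\<close> by blast
      next
        case False
        then have "e < x" using ne[of x] m e(3) by auto
        then show False using noB[of e x y z] m o e by blast
      qed
    qed
  qed
qed

text \<open>A crossing with the merged block uses points of only one old block, which
  \<open>P\<close> excludes, or of both, which \<open>merge_no_crossing\<close> excludes.\<close>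

lemma merge_blocks_ncp:
  assumes P: "P \<in> ncp U" "B \<in> P" "C \<in> P" and v: "v \<in> B" "Suc v \<in> C"
  shows "insert (B \<union> C) (P - {B, C}) \<in> ncp U" (is "?P' \<in> _")
proof (rule ncpI)
  show "\<Union>?P' = U" using P by (auto simp: ncp_def partition_on_def)
  show "{} \<notin> ?P'" using P v ncp_nonempty[OF P(1)] by auto
next
  fix V W x assume "V \<in> ?P'" "W \<in> ?P'" "x \<in> V" "x \<in> W"
  then show "V = W"
    using ncp_block_unique[OF P(1) P(2), of _ x] ncp_block_unique[OF P(1) P(3), of _ x]
      ncp_block_unique[OF P(1), of V W x]
    by (elim insertE DiffE) auto
next
  fix V W x y z w
  assume VW: "V \<in> ?P'" "W \<in> ?P'" and o: "x < y" "y < z" "z < w"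
    and m: "x \<in> V" "z \<in> V" "y \<in> W" "w \<in> W"
  note nc = noncrossingD[OF P(1) _ _ o]
  show "V = W"
  proof (cases "V = B \<union> C")
    case True
    show ?thesis
    proof (rule ccontr)
      assume "V \<noteq> W"
      then have W: "W \<in> P" "W \<noteq> B" "W \<noteq> C" using VW True by auto
      show False
        using nc[OF P(2) W(1)] nc[OF P(3) W(1)] m W True
          merge_no_crossing(1)[OF P W v _ o] merge_no_crossing(1)[OF P(1,3,2) W(1,3,2) v(2,1) _ o]
        by blast
    qed
  next
    case False
    then have V: "V \<in> P" "V \<noteq> B" "V \<noteq> C" using VW by auto
    show ?thesis
    proof (cases "W = B \<union> C")
      case True
      show ?thesis
        using nc[OF V(1) P(2)] nc[OF V(1) P(3)] m V True
          merge_no_crossing(2)[OF P V v _ o] merge_no_crossing(2)[OF P(1,3,2) V(1,3,2) v(2,1) _ o]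
        by blast
    next
      case False
      then show ?thesis using nc[OF V(1), of W] VW m by auto
    qed
  qed
qed

text \<open>Since the blocks do not cross, \<open>C\<close> lies in the cyclic gap of
  \<open>B\<close> that follows \<open>v\<close>. Read cyclically from \<open>v\<close>, the union
  therefore runs through all of \<open>C\<close>, starting at \<open>Suc v\<close>, and then through
  the rest \<open>X\<close> of \<open>B\<close>.\<close>

lemma merge_blocks_cyc_pairs:
  assumes P: "P \<in> ncp U" "finite U" "B \<in> P" "C \<in> P" "B \<noteq> C" and v: "v \<in> B" "Suc v \<in> C"
  obtains X T where "cyc_pairs (sorted_list_of_set B) = cyc_pairs (v # X)"
    "cyc_pairs (sorted_list_of_set C) = cyc_pairs (Suc v # T)"
    "cyc_pairs (sorted_list_of_set (B \<union> C)) = cyc_pairs (v # Suc v # T @ X)"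
    "insert v (set X) = B" "insert (Suc v) (set T) = C" "distinct (v # Suc v # T @ X)"
proof -
  let ?sl = "sorted_list_of_set :: nat set \<Rightarrow> nat list"
  have fin: "finite B" "finite C" using P ncp_subset finite_subset by metis+
  have disj: "B \<inter> C = {}" using P(5) ncp_block_unique[OF P(1,3,4)] by blast
  define B1 where "B1 = {x \<in> B. x < v}"
  define B2 where "B2 = {x \<in> B. x > v}"
  define C1 where "C1 = {x \<in> C. x < Suc v}"
  define C2 where "C2 = {x \<in> C. x > Suc v}"
  have finS: "finite B1" "finite B2" "finite C1" "finite C2"
    using fin by (auto simp: B1_def B2_def C1_def C2_def)
  have B: "B = B1 \<union> ({v} \<union> B2)" using v by (auto simp: B1_def B2_def)
  have C: "C = C1 \<union> ({Suc v} \<union> C2)" using v by (auto simp: C1_def C2_def)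
  have slB: "?sl B = ?sl B1 @ v # ?sl B2"
  proof -
    have "a < b" if "a \<in> B1" "b \<in> {v} \<union> B2" for a b
      using that by (auto simp: B1_def B2_def)
    moreover have "a < b" if "a \<in> {v}" "b \<in> B2" for a b
      using that by (auto simp: B2_def)
    ultimately show ?thesis
      unfolding B using finS sorted_list_of_set_Un[of B1 "{v} \<union> B2"]
        sorted_list_of_set_Un[of "{v}" B2] by simp
  qed
  have slC: "?sl C = ?sl C1 @ Suc v # ?sl C2"
  proof -
    have "a < b" if "a \<in> C1" "b \<in> {Suc v} \<union> C2" for a b
      using that by (auto simp: C1_def C2_def)
    moreover have "a < b" if "a \<in> {Suc v}" "b \<in> C2" for a b
      using that by (auto simp: C2_def)
    ultimately show ?thesis
      unfolding C using finS sorted_list_of_set_Un[of C1 "{Suc v} \<union> C2"]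
        sorted_list_of_set_Un[of "{Suc v}" C2] by simp
  qed
  have C1lt: "x < v" if "x \<in> C1" for x
    using that v disj by (auto simp: C1_def less_Suc_eq)
  have B2gt: "x > Suc v" if "x \<in> B2" for x
    using that v disj by (metis B2_def Suc_lessI disjoint_iff mem_Collect_eq)
  \<comment> \<open>Otherwise \<open>x < v < Suc v < y\<close> would be a crossing of
    \<open>C\<close> and \<open>B\<close>.\<close>
  have not_both: "\<not> (x \<in> C1 \<and> y \<in> B2)" for x y
    using noncrossingD[OF P(1) P(4) P(3), of x v "Suc v" y] C1lt[of x] B2gt[of y] v P(5)
    by (auto simp: C1_def B2_def)
  have C2B2: "x < y" if "x \<in> C2" "y \<in> B2" for x y
  proof (rule ccontr)
    assume "\<not> x < y"
    moreover have "x \<noteq> y" using that disj by (auto simp: C2_def B2_def)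
    ultimately show False
      using noncrossingD[OF P(1) P(3) P(4), of v "Suc v" y x] B2gt[OF that(2)] that v P(5)
      by (auto simp: C2_def B2_def)
  qed
  have C1B1: "x < y" if "x \<in> C1" "y \<in> B1" for x y
  proof (rule ccontr)
    assume "\<not> x < y"
    moreover have "x \<noteq> y" using that disj by (auto simp: C1_def B1_def)
    ultimately show False
      using noncrossingD[OF P(1) P(3) P(4), of y x v "Suc v"] C1lt[OF that(1)] that v P(5)
      by (auto simp: C1_def B1_def)
  qed
  have slBC: "cyc_pairs (?sl (B \<union> C)) = cyc_pairs (v # Suc v # (?sl C2 @ ?sl C1) @ ?sl B2 @ ?sl B1)"
  proof -
    have BC: "B \<union> C = C1 \<union> (B1 \<union> ({v} \<union> ({Suc v} \<union> (C2 \<union> B2))))"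
      unfolding B C by blast
    have c1: "x < y" if "x \<in> C1" "y \<in> B1 \<union> ({v} \<union> ({Suc v} \<union> (C2 \<union> B2)))" for x y
      using that C1B1 C1lt[of x] by (fastforce simp: C2_def B2_def)
    have c2: "x < y" if "x \<in> B1" "y \<in> {v} \<union> ({Suc v} \<union> (C2 \<union> B2))" for x y
      using that by (auto simp: B1_def C2_def B2_def)
    have c3: "x < y" if "x \<in> {v}" "y \<in> {Suc v} \<union> (C2 \<union> B2)" for x y
      using that by (auto simp: C2_def B2_def)
    have c4: "x < y" if "x \<in> {Suc v}" "y \<in> C2 \<union> B2" for x y
      using that B2gt by (auto simp: C2_def)
    have "?sl (B \<union> C) = ?sl C1 @ ?sl B1 @ ?sl {v} @ ?sl {Suc v} @ ?sl C2 @ ?sl B2"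
    proof -
      have "?sl (C2 \<union> B2) = ?sl C2 @ ?sl B2"
        using finS C2B2 by (intro sorted_list_of_set_Un) auto
      moreover have "?sl ({Suc v} \<union> (C2 \<union> B2)) = ?sl {Suc v} @ ?sl (C2 \<union> B2)"
        using finS by (intro sorted_list_of_set_Un c4) auto
      moreover have "?sl ({v} \<union> ({Suc v} \<union> (C2 \<union> B2))) = ?sl {v} @ ?sl ({Suc v} \<union> (C2 \<union> B2))"
        using finS by (intro sorted_list_of_set_Un c3) auto
      moreover have "?sl (B1 \<union> ({v} \<union> ({Suc v} \<union> (C2 \<union> B2)))) =
          ?sl B1 @ ?sl ({v} \<union> ({Suc v} \<union> (C2 \<union> B2)))"
        using finS by (intro sorted_list_of_set_Un c2) auto
      moreover have "?sl (B \<union> C) = ?sl C1 @ ?sl (B1 \<union> ({v} \<union> ({Suc v} \<union> (C2 \<union> B2))))"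
        unfolding BC using finS by (intro sorted_list_of_set_Un c1) auto
      ultimately show ?thesis by (simp only:)
    qed
    also have "cyc_pairs \<dots> = cyc_pairs (v # Suc v # ?sl C2 @ ?sl B2 @ ?sl C1 @ ?sl B1)"
      using cyc_pairs_rotate[of "?sl C1 @ ?sl B1" "v # Suc v # ?sl C2 @ ?sl B2"] by simp
    \<comment> \<open>By \<open>not_both\<close> one of the lists of \<open>C1\<close> and
      \<open>B2\<close> is empty, so they may be exchanged.\<close>
    also have "?sl C2 @ ?sl B2 @ ?sl C1 @ ?sl B1 = (?sl C2 @ ?sl C1) @ ?sl B2 @ ?sl B1"
      using not_both finS by (cases "C1 = {}"; cases "B2 = {}") auto
    finally show ?thesis .
  qed
  have dis: "distinct (?sl C2 @ ?sl C1 @ ?sl B2 @ ?sl B1)" "v \<notin> C" "Suc v \<notin> B"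
    using finS disj v by (auto simp: B1_def B2_def C1_def C2_def)
  show thesis
  proof (rule that[of "?sl B2 @ ?sl B1" "?sl C2 @ ?sl C1"])
    show "cyc_pairs (?sl B) = cyc_pairs (v # ?sl B2 @ ?sl B1)"
      using slB cyc_pairs_rotate[of "?sl B1" "v # ?sl B2"] by simp
    show "cyc_pairs (?sl C) = cyc_pairs (Suc v # ?sl C2 @ ?sl C1)"
      using slC cyc_pairs_rotate[of "?sl C1" "Suc v # ?sl C2"] by simp
    show "insert v (set (?sl B2 @ ?sl B1)) = B" using finS by (subst B) auto
    show "insert (Suc v) (set (?sl C2 @ ?sl C1)) = C" using finS by (subst C) auto
    show "distinct (v # Suc v # (?sl C2 @ ?sl C1) @ ?sl B2 @ ?sl B1)"
      using dis finS by (auto simp: B1_def B2_def C1_def C2_def)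
  qed (fact slBC)
qed

text \<open>An element of \<open>S\<close> amounts to the element whose coordinate \<open>z\<close>
  is overwritten by coordinate \<open>w\<close>, together with the forgotten value at
  \<open>z\<close>, which is arbitrary.\<close>

lemma card_free_coordinate:
  fixes S :: "'n::finite list set"
  assumes len: "\<And>is. is \<in> S \<Longrightarrow> length is = p" and z: "z < p" "w \<noteq> z"
    and closed: "\<And>is a. is \<in> S \<Longrightarrow> is[z := a] \<in> S"
  shows "card S = CARD('n) * card {is \<in> S. is ! z = is ! w}"
proof -
  have "bij_betw (\<lambda>(is, a). is[z := a]) ({is \<in> S. is ! z = is ! w} \<times> (UNIV :: 'n set)) S"
  proof (rule bij_betw_byWitness[where f' = "\<lambda>is. (is[z := is ! w], is ! z)"])
    show "\<forall>q\<in>{is \<in> S. is ! z = is ! w} \<times> UNIV.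
        ((case q of (is, a) \<Rightarrow> is[z := a])[z := (case q of (is, a) \<Rightarrow> is[z := a]) ! w],
         (case q of (is, a) \<Rightarrow> is[z := a]) ! z) = q"
      using z len by (auto simp: list_update_same_conv)
  qed (use z closed len in \<open>auto simp: nth_list_update\<close>)
  then show ?thesis by (simp add: bij_betw_same_card[symmetric] card_cartesian_product)
qed

text \<open>
  \<open>edges P\<close> is the graph of the permutation that rotates each block of \<open>P\<close> in increasing order.
\<close>

definition edges :: "nat set set \<Rightarrow> (nat \<times> nat) set" where
  "edges P = (\<Union>B\<in>P. cyc_pairs (sorted_list_of_set B))"

text \<open>With \<open>g\<close> as the permutation of the intervals and \<open>E\<close> as the
  graph of the permutation of \<pi>, these are the index equations
  \<open>i (\<gamma> x) = i (\<pi> x)\<close>.\<close>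

definition solutions :: "nat \<Rightarrow> (nat \<Rightarrow> nat) \<Rightarrow> (nat \<times> nat) set \<Rightarrow> 'n list set" where
  "solutions p g E = {is. length is = p \<and> (\<forall>(x, y)\<in>E. is ! g x = is ! y)}"

lemma finite_lists_length: "finite {is :: 'n::finite list. length is = p}"
  using finite_lists_length_eq[of "UNIV :: 'n set" p] by simp

lemma card_lists_length: "card {is :: 'n::finite list. length is = p} = CARD('n) ^ p"
  using card_lists_length_eq[of "UNIV :: 'n set" p] by simp

text \<open>Every \<open>z\<close> is a free coordinate until its equation is imposed, which divides
  the count by \<open>CARD('n)\<close>. The product form avoids subtraction in the exponent.\<close>

lemma card_constant_on:
  fixes Z :: "nat set"
  assumes "finite Z" "Z \<subseteq> {..<p}" "0 \<notin> Z"
  shows "card {is :: 'n::finite list. length is = p \<and> (\<forall>z\<in>Z. is ! z = is ! 0)} * CARD('n) ^ card Z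
    = CARD('n) ^ p"
  using assms
proof (induction Z)
  case empty
  then show ?case by (simp add: card_lists_length)
next
  case (insert z Z)
  let ?S = "{is :: 'n list. length is = p \<and> (\<forall>z\<in>Z. is ! z = is ! 0)}"
  have "card ?S = CARD('n) * card {is \<in> ?S. is ! z = is ! 0}"
  proof (rule card_free_coordinate)
    show "z < p" "0 \<noteq> z" using insert.prems by auto
    fix "is" a assume S: "is \<in> ?S"
    have "is[z := a] ! y = is[z := a] ! 0" if "y \<in> Z" for y
    proof -
      have "y \<noteq> z" "z \<noteq> 0" using that insert.hyps insert.prems by auto
      then show ?thesis using S that by simp
    qed
    then show "is[z := a] \<in> ?S" using S by simp
  qed simp
  also have "{is \<in> ?S. is ! z = is ! 0} =
      {is. length is = p \<and> (\<forall>z\<in>insert z Z. is ! z = is ! 0)}" by auto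
  finally show ?case using insert.IH insert.prems insert.hyps by (simp add: mult_ac)
qed

text \<open>By \<open>cyc_pairs_merge\<close>, merging replaces the edges \<open>(v, w)\<close> and
  \<open>(u, Suc v)\<close> by \<open>(v, Suc v)\<close> and \<open>(u, w)\<close>. The new equation
  at \<open>v\<close> is trivial, and no other one involves coordinate \<open>Suc v\<close>, which
  becomes free. Tying it to coordinate \<open>w\<close> restores the system of
  \<open>P\<close>.\<close>

lemma solutions_merge:
  fixes g :: "nat \<Rightarrow> nat"
  assumes P: "P \<in> ncp {..<p}" "B \<in> P" "C \<in> P" "B \<noteq> C" and v: "v \<in> B" "Suc v \<in> C"
    and g: "inj_on g {..<p}" "g v = Suc v"
  shows "card (solutions p g (edges (insert (B \<union> C) (P - {B, C}))) :: 'n::finite list set) =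
    CARD('n) * card (solutions p g (edges P) :: 'n list set)"
proof -
  obtain X T where XT: "cyc_pairs (sorted_list_of_set B) = cyc_pairs (v # X)"
    "cyc_pairs (sorted_list_of_set C) = cyc_pairs (Suc v # T)"
    "cyc_pairs (sorted_list_of_set (B \<union> C)) = cyc_pairs (v # Suc v # T @ X)"
    "insert v (set X) = B" "insert (Suc v) (set T) = C" "distinct (v # Suc v # T @ X)"
    by (rule merge_blocks_cyc_pairs[OF P(1) _ P(2-4) v]) auto
  obtain w u F where F: "cyc_pairs (v # X) \<union> cyc_pairs (Suc v # T) = F \<union> {(v, w), (u, Suc v)}"
    "cyc_pairs (v # Suc v # T @ X) = F \<union> {(v, Suc v), (u, w)}"
    "w \<in> insert v (set X)" "u \<in> insert (Suc v) (set T)"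
    "F \<subseteq> (set X \<union> insert (Suc v) (set T)) \<times> (insert v (set X) \<union> set T)"
    by (rule cyc_pairs_merge[OF XT(6)])
  define R where "R = edges (P - {B, C})"
  have "x \<in> \<Union>(P - {B, C}) \<and> y \<in> \<Union>(P - {B, C})" if xy: "(x, y) \<in> R" for x y
  proof -
    obtain D where D: "D \<in> P - {B, C}" "(x, y) \<in> cyc_pairs (sorted_list_of_set D)"
      using xy unfolding R_def edges_def by blast
    have "finite D" using D(1) ncp_subset[OF P(1)] finite_subset by blast
    then have "x \<in> D" "y \<in> D"
      using set_zip_leftD[OF D(2)[unfolded cyc_pairs_def]] set_zip_rightD[OF D(2)[unfolded cyc_pairs_def]]
      by simp_all
    then show ?thesis using D(1) by blast
  qed
  moreover have "v \<notin> \<Union>(P - {B, C})" "Suc v \<notin> \<Union>(P - {B, C})"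
    using ncp_block_unique[OF P(1) P(2) _ v(1)] ncp_block_unique[OF P(1) P(3) _ v(2)] by auto
  moreover have "\<Union>(P - {B, C}) \<subseteq> {..<p}" using P(1) ncp_subset by blast
  ultimately have R: "x < p" "x \<noteq> v" "y \<noteq> Suc v" if "(x, y) \<in> R" for x y
    using that by (metis lessThan_iff subsetD)+
  have dis: "v \<notin> C" "Suc v \<notin> B" using XT(4-6) by auto
  have BCp: "B \<subseteq> {..<p}" "C \<subseteq> {..<p}" using P ncp_subset by blast+
  have wu: "w \<noteq> Suc v" "u \<noteq> v" "u < p" using F(3,4) XT(4,5) dis BCp by auto
  have FX: "x < p" "x \<noteq> v" "y \<noteq> Suc v" if "(x, y) \<in> F" for x y
  proof -
    have "x \<in> set X \<union> insert (Suc v) (set T)" "y \<in> insert v (set X) \<union> set T"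
      using subsetD[OF F(5) that] by (simp_all only: mem_Sigma_iff)
    then show "x < p" "x \<noteq> v" "y \<noteq> Suc v" using XT(4-6) BCp by auto
  qed
  have eq: "edges P = R \<union> F \<union> {(v, w), (u, Suc v)}"
  proof -
    have "edges P = cyc_pairs (sorted_list_of_set B) \<union> cyc_pairs (sorted_list_of_set C) \<union> R"
      using P(2,3) by (auto simp: edges_def R_def)
    then show ?thesis using XT(1,2) F(1) by auto
  qed
  have eq': "edges (insert (B \<union> C) (P - {B, C})) = R \<union> F \<union> {(v, Suc v), (u, w)}"
    using XT(3) F(2) by (auto simp: edges_def R_def)
  \<comment> \<open>Injectivity keeps coordinate \<open>Suc v\<close> off the left side of all
    equations except the one at \<open>v\<close>; \<open>R\<close> and \<open>FX\<close> keep it off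
    the right side.\<close>
  have gne: "g x \<noteq> Suc v" if "x < p" "x \<noteq> v" for x
  proof
    assume "g x = Suc v"
    then have "g x = g v" using g by simp
    moreover have "v < p" using v BCp by auto
    ultimately show False using g(1) that by (auto dest: inj_onD)
  qed
  let ?S = "solutions p g (R \<union> F \<union> {(v, Suc v), (u, w)}) :: 'n list set"
  have "card ?S = CARD('n) * card {is \<in> ?S. is ! Suc v = is ! w}"
  proof (rule card_free_coordinate)
    show "Suc v < p" using v BCp by auto
    show "w \<noteq> Suc v" by fact
    fix "is" a assume S: "is \<in> ?S"
    have keep: "is[Suc v := a] ! g x = is[Suc v := a] ! y"
      if "(x, y) \<in> R \<union> F \<union> {(u, w)}" for x y
    proof -
      have "x < p" "x \<noteq> v" "y \<noteq> Suc v" using that R[of x y] FX[of x y] wu by auto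
      moreover have "is ! g x = is ! y" using S that by (auto simp: solutions_def)
      ultimately show ?thesis using gne[of x] by simp
    qed
    have "is[Suc v := a] ! g v = is[Suc v := a] ! Suc v" using g(2) by simp
    then show "is[Suc v := a] \<in> ?S"
      using S keep unfolding solutions_def by auto
  qed (simp add: solutions_def)
  \<comment> \<open>As \<open>g v = Suc v\<close>, the edge \<open>(v, w)\<close> of \<open>P\<close> is the equation \<open>is ! Suc v = is ! w\<close>.\<close>
  also have "{is \<in> ?S. is ! Suc v = is ! w} = solutions p g (edges P)"
    unfolding eq using g(2) by (auto simp: solutions_def)
  finally show ?thesis unfolding eq' .
qed

text \<open>The permutation \<gamma> that rotates every interval; positions beyond the last interval
  are fixed.\<close>

fun block_succ :: "nat list \<Rightarrow> nat \<Rightarrow> nat" where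
  "block_succ [] x = x"
| "block_succ (p # ps) x = (if x < p then Suc x mod p else p + block_succ ps (x - p))"

lemma inj_block_succ: "inj_on (block_succ ps) {..<sum_list ps}"
proof (induction ps)
  case (Cons p ps)
  show ?case
  proof (rule inj_onI)
    fix x y assume xy: "x \<in> {..<sum_list (p # ps)}" "y \<in> {..<sum_list (p # ps)}"
      "block_succ (p # ps) x = block_succ (p # ps) y"
    have ne: "Suc z mod p \<noteq> p + k" "p + k \<noteq> Suc z mod p" if "z < p" for z k
    proof -
      have "Suc z mod p < p" using that by simp
      then show "Suc z mod p \<noteq> p + k" "p + k \<noteq> Suc z mod p" by linarith+
    qed
    consider "x < p" "y < p" | "x \<ge> p" "y \<ge> p"
      using xy(3) ne by (cases "x < p"; cases "y < p") auto
    then show "x = y"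
    proof cases
      case 1
      then show ?thesis using xy by (auto simp: mod_Suc split: if_splits)
    next
      case 2
      then have "block_succ ps (x - p) = block_succ ps (y - p)" using xy by simp
      then have "x - p = y - p" using Cons 2 xy by (auto dest!: inj_onD)
      then show ?thesis using 2 by linarith
    qed
  qed
qed simp

lemma block_succ_eq:
  assumes "x < sum_list ps"
  shows "block_succ ps x = (if Suc x < sum_list ps \<and> block_index ps (Suc x) = block_index ps x
    then Suc x else sum_list (take (block_index ps x) ps))"
  using assms
proof (induction ps arbitrary: x)
  case (Cons p ps)
  show ?case
  proof (cases "x < p")
    case True
    then show ?thesis by (cases "Suc x = p") auto
  next
    case False
    then have "Suc x - p = Suc (x - p)" "x - p < sum_list ps" using Cons.prems by auto
    then show ?thesis using False Cons.IH[of "x - p"] by auto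
  qed
qed simp

lemma cyc_pairs_upt: "cyc_pairs [0..<p] = {(x, Suc x mod p) |x. x < p}"
  by (force simp: cyc_pairs_def set_zip nth_rotate1)

text \<open>Inside an interval both permutations move \<open>x\<close> to \<open>Suc x\<close>, so
  only right ends give equations. These equate the left endpoints of cyclically consecutive
  intervals, which ties all but one of the \<open>s\<close> left endpoints to coordinate 0.\<close>

lemma card_solutions_single_block:
  assumes ps: "\<forall>p\<in>set ps. p \<ge> 1" "ps \<noteq> []"
  shows "card (solutions (sum_list ps) (block_succ ps) (edges {{..<sum_list ps}}) :: 'n::finite list set)
    * CARD('n) ^ (1 + length ps) = CARD('n) ^ (sum_list ps + 2)"
proof -
  define p where "p = sum_list ps"
  define s where "s = length ps"
  define f where "f k = sum_list (take k ps)" for k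
  have s: "s > 0" using ps by (simp add: s_def)
  have f0: "f 0 = 0" and fs: "f s = p" by (simp_all add: f_def s_def p_def)
  have step: "f k < f (Suc k)" if "k < s" for k
  proof -
    have "ps ! k \<ge> 1" using that ps by (auto simp: s_def)
    then show ?thesis using that by (simp add: f_def s_def take_Suc_conv_app_nth)
  qed
  have less: "f j < f k" if "j < k" "k \<le> s" for j k
    using that
  proof (induction k)
    case (Suc k)
    then show ?case using step[of k] by (cases "j = k") auto
  qed simp
  have bi: "block_index ps x = k \<longleftrightarrow> f k \<le> x \<and> x < f (Suc k)" if "x < p" "k < s" for x k
    using block_index_eq_iff that by (simp add: f_def p_def s_def)
  have p: "p > 0" using less[of 0 s] s f0 fs by simp
  \<comment> \<open>The left endpoints other than 0; \<open>f k\<close> is the left endpoint of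
    interval \<open>k\<close>, and \<open>f s\<close> is the total length.\<close>
  define Z where "Z = f ` {1..<s}"
  have "inj_on f {1..<s}"
    by (rule inj_onI) (metis atLeastLessThan_iff less less_imp_le less_irrefl linorder_neqE_nat)
  then have cardZ: "card Z = s - 1" by (simp add: Z_def card_image)
  have "0 < f k \<and> f k < p" if "k \<in> {1..<s}" for k
    using less[of 0 k] less[of k s] f0 fs that by simp
  then have Z: "finite Z" "Z \<subseteq> {..<p}" "0 \<notin> Z"
    by (fastforce simp: Z_def)+
  have iff: "(\<forall>x<p. is ! block_succ ps x = is ! (Suc x mod p)) \<longleftrightarrow> (\<forall>z\<in>Z. is ! z = is ! 0)"
    for "is" :: "'n list"
  proof
    assume sol: "\<forall>x<p. is ! block_succ ps x = is ! (Suc x mod p)"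
    have eq: "is ! f k = is ! f (Suc k)" if "Suc k < s" for k
    proof -
      \<comment> \<open>The right end of interval \<open>k\<close>: there \<open>block_succ\<close>
        returns to \<open>f k\<close>, while the full cycle moves on to
        \<open>f (Suc k)\<close>.\<close>
      define x where "x = f (Suc k) - 1"
      have x: "Suc x = f (Suc k)" using step[of k] that by (simp add: x_def)
      have lt: "f (Suc k) < p" using less[of "Suc k" s] that fs by simp
      have "block_index ps x = k" using bi[of x k] step[of k] lt x that by simp
      moreover have "block_index ps (Suc x) \<noteq> k" using bi[of "Suc x" k] lt x that by simp
      ultimately have "block_succ ps x = f k"
        using block_succ_eq[of x ps] lt x by (simp add: f_def p_def)
      then show ?thesis using sol lt x by (metis Suc_lessD mod_less)
    qed
    have "is ! f k = is ! 0" if "k < s" for k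
      using that by (induction k) (use eq f0 in auto)
    then show "\<forall>z\<in>Z. is ! z = is ! 0" by (auto simp: Z_def)
  next
    assume "\<forall>z\<in>Z. is ! z = is ! 0"
    then have const: "is ! f k = is ! 0" if "k < s" for k
      using that f0 by (cases "k = 0") (auto simp: Z_def)
    show "\<forall>x<p. is ! block_succ ps x = is ! (Suc x mod p)"
    proof (intro allI impI)
      fix x assume x: "x < p"
      have bx: "block_index ps x < s" using block_index_less x by (simp add: p_def s_def)
      show "is ! block_succ ps x = is ! (Suc x mod p)"
      proof (cases "Suc x < p \<and> block_index ps (Suc x) = block_index ps x")
        case True
        then show ?thesis using block_succ_eq[of x ps] x by (simp add: p_def)
      next
        case False
        then have "block_succ ps x = f (block_index ps x)"
          using block_succ_eq[of x ps] x by (auto simp: p_def f_def)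
        then have 1: "is ! block_succ ps x = is ! 0" using const bx by simp
        show ?thesis
        proof (cases "Suc x < p")
          case True
          define k where "k = block_index ps (Suc x)"
          have k: "k < s" using block_index_less True by (simp add: p_def s_def k_def)
          have "f k \<le> Suc x \<and> Suc x < f (Suc k)" using bi[OF True k] by (simp add: k_def)
          moreover have "\<not> (f k \<le> x \<and> x < f (Suc k))"
            using bi[OF x k] False True by (auto simp: k_def)
          ultimately have "Suc x = f k" by linarith
          then show ?thesis using 1 const[OF k] True by simp
        next
          case False
          then have "Suc x = p" using x by simp
          then show ?thesis using 1 by simp
        qed
      qed
    qed
  qed
  have "solutions p (block_succ ps) (edges {{..<p}}) =
      {is :: 'n list. length is = p \<and> (\<forall>z\<in>Z. is ! z = is ! 0)}"
    unfolding iff[symmetric]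
    by (auto simp: solutions_def edges_def cyc_pairs_upt lessThan_atLeast0)
  then have "card (solutions p (block_succ ps) (edges {{..<p}}) :: 'n list set) * CARD('n) ^ (s - 1) = CARD('n) ^ p"
    using card_constant_on[OF Z, where 'n = 'n] cardZ by simp
  \<comment> \<open>As \<open>s > 0\<close>, the exponent \<open>1 + s\<close> is
    \<open>(s - 1) + 2\<close>; the extra 2 matches that of \<open>p + 2\<close>.\<close>
  moreover have "CARD('n) ^ (1 + s) = CARD('n) ^ (s - 1) * CARD('n) ^ 2"
    using s by (simp flip: power_add)
  moreover have "CARD('n) ^ (p + 2) = CARD('n) ^ p * CARD('n) ^ 2" by (rule power_add)
  ultimately show ?thesis
    by (simp only: p_def[symmetric] s_def[symmetric] mult.assoc[symmetric])
qed

text \<open>If neighbours in an interval always shared a block, every block would be a union of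
  intervals. Then \<open>P\<close> would itself lie in \<open>sat_ncp\<close>, and connectedness
  would make it the one-block partition.\<close>

lemma conn_ncp_adjacent_blocks:
  assumes P: "P \<in> conn_ncp b {..<p}" "P \<noteq> {{..<p}}" and mono: "\<And>x y. x \<le> y \<Longrightarrow> b x \<le> b y"
  obtains v B C where "Suc v < p" "b (Suc v) = b v" "B \<in> P" "C \<in> P" "v \<in> B" "Suc v \<in> C" "B \<noteq> C"
proof (rule ccontr)
  assume not: "\<not> thesis"
  note adjacent = that
  have Pn: "P \<in> ncp {..<p}" using P by (simp add: conn_ncp_def)
  have same: "v \<in> V \<longleftrightarrow> Suc v \<in> V" if v: "Suc v < p" "b (Suc v) = b v" and V: "V \<in> P" for v V
  proof -
    obtain B C where BC: "B \<in> P" "v \<in> B" "C \<in> P" "Suc v \<in> C"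
      using ncp_cover[OF Pn, of v] ncp_cover[OF Pn, of "Suc v"] v by auto
    then have "B = C" using adjacent[OF v, of B C] not BC by blast
    then show ?thesis
      using ncp_block_unique[OF Pn BC(1) V] ncp_block_unique[OF Pn V] BC by metis
  qed
  have iff: "x \<in> V \<longleftrightarrow> y \<in> V" if "x \<le> y" "y < p" "b x = b y" "V \<in> P" for x y V
    using that
  proof (induction y rule: dec_induct)
    case (step y)
    then have "b x = b y" "b (Suc y) = b y" using mono[of x y] mono[of y "Suc y"] by auto
    then show ?case using step same[of y V] by auto
  qed simp
  have "saturated b {..<p} V" if V: "V \<in> P" for V
    unfolding saturated_def
  proof (intro ballI impI)
    fix x y assume xy: "x \<in> V" "y \<in> {..<p}" "b x = b y"
    then have "x < p" "y < p" using V ncp_subset[OF Pn] by auto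
    then show "y \<in> V"
      using iff[OF _ _ xy(3) V] iff[OF _ _ xy(3)[symmetric] V] xy(1) by (meson linear)
  qed
  then have "P \<in> sat_ncp b {..<p}" using Pn by (simp add: sat_ncp_def)
  then show False using P by (auto simp: conn_ncp_def finer_def)
qed

text \<open>Induction on the number of blocks: merging two blocks at neighbours in an interval
  removes one block and multiplies the count by \<open>CARD('n)\<close>, so the left-hand product
  does not change.\<close>

lemma card_solutions:
  assumes ps: "\<forall>p\<in>set ps. p \<ge> 1" "ps \<noteq> []"
    and P: "P \<in> conn_ncp (block_index ps) {..<sum_list ps}"
  shows "card (solutions (sum_list ps) (block_succ ps) (edges P) :: 'n::finite list set)
    * CARD('n) ^ (card P + length ps) = CARD('n) ^ (sum_list ps + 2)"
  using P
proof (induction "card P" arbitrary: P rule: less_induct)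
  case less
  define U where "U = {..<sum_list ps}"
  show ?case
  proof (cases "P = {U}")
    case True
    then show ?thesis using card_solutions_single_block[OF ps, where 'n = 'n] by (simp add: U_def)
  next
    case False
    then obtain v B C where v: "Suc v < sum_list ps" "block_index ps (Suc v) = block_index ps v"
      "B \<in> P" "C \<in> P" "v \<in> B" "Suc v \<in> C" "B \<noteq> C"
      using conn_ncp_adjacent_blocks[OF less.prems] block_index_mono by (metis U_def)
    define Q where "Q = insert (B \<union> C) (P - {B, C})"
    have Pn: "P \<in> ncp U" using less.prems by (simp add: conn_ncp_def U_def)
    have "finite P" using finite_ncp_elem[OF _ Pn] by (simp add: U_def)
    moreover have "B \<union> C \<notin> P"
      using ncp_block_unique[OF Pn _ v(3), of "B \<union> C" v] ncp_block_unique[OF Pn _ v(4), of "B \<union> C" "Suc v"] v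
      by auto
    ultimately have cardQ: "Suc (card Q) = card P"
    proof -
      have "card {B, C} \<le> card P" using v \<open>finite P\<close> by (intro card_mono) auto
      moreover have "card (P - {B, C}) = card P - card {B, C}" using v by (intro card_Diff_subset) auto
      ultimately show ?thesis using v \<open>finite P\<close> \<open>B \<union> C \<notin> P\<close> by (simp add: Q_def)
    qed
    have "Q \<in> ncp U" unfolding Q_def using merge_blocks_ncp[OF Pn v(3-6)] .
    \<comment> \<open>Merging preserves connectedness, because whatever is coarser than
      \<open>Q\<close> is coarser than \<open>P\<close>.\<close>
    moreover have "finer P S" if Q: "finer Q S" for S
      unfolding finer_def
    proof
      fix D assume "D \<in> P"
      then obtain D' where "D' \<in> Q" "D \<subseteq> D'" by (auto simp: Q_def)
      then show "\<exists>V\<in>S. D \<subseteq> V" using Q unfolding finer_def by (meson order.trans)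
    qed
    ultimately have Qc: "Q \<in> conn_ncp (block_index ps) {..<sum_list ps}"
      using less.prems by (auto simp: conn_ncp_def U_def)
    have "block_succ ps v = Suc v" using block_succ_eq[of v ps] v by simp
    then have "card (solutions (sum_list ps) (block_succ ps) (edges Q) :: 'n list set) =
        CARD('n) * card (solutions (sum_list ps) (block_succ ps) (edges P) :: 'n list set)"
      unfolding Q_def using Pn v inj_block_succ by (intro solutions_merge) (auto simp: U_def)
    moreover have "card Q < card P" using cardQ by simp
    note less.hyps[OF this Qc]
    ultimately show ?thesis unfolding cardQ[symmetric] by (simp add: mult_ac)
  qed
qed

section \<open>Expansion of the traces\<close>

lemma sum_lists_append:
  "(\<Sum>is :: 'n::finite list | length is = p + q. f is) =
    (\<Sum>is | length is = p. \<Sum>js | length js = q. f (is @ js))"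
proof -
  have "(\<Sum>is :: 'n list | length is = p. \<Sum>js | length js = q. f (is @ js)) =
      (\<Sum>(is, js)\<in>{is. length is = p} \<times> {js. length js = q}. f (is @ js))"
    by (rule sum.cartesian_product)
  also have "\<dots> = (\<Sum>is | length is = p + q. f is)"
    by (rule sum.reindex_bij_witness[where i = "\<lambda>is. (take p is, drop p is)" and j = "\<lambda>(is, js). is @ js"])
      auto
  finally show ?thesis by simp
qed

lemma sum_lists_Suc:
  "(\<Sum>is :: 'n::finite list | length is = Suc q. f is) = (\<Sum>i\<in>UNIV. \<Sum>is | length is = q. f (i # is))"
proof -
  have "(\<Sum>i\<in>UNIV. \<Sum>is :: 'n list | length is = q. f (i # is)) =
      (\<Sum>(i, is)\<in>UNIV \<times> {is. length is = q}. f (i # is))"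
    by (rule sum.cartesian_product)
  also have "\<dots> = (\<Sum>is | length is = Suc q. f is)"
    by (rule sum.reindex_bij_witness[where i = "\<lambda>is. (hd is, tl is)" and j = "\<lambda>(i, is). i # is"])
      (auto simp: length_Suc_conv)
  finally show ?thesis by simp
qed

text \<open>The sum runs over walks from \<open>i\<close> to \<open>j\<close>, with
  \<open>is\<close> listing the \<open>q\<close> intermediate vertices.\<close>

lemma mat_power_Suc_entry:
  fixes M :: "'a::semiring_1^'n^'n"
  shows "mat_power M (Suc q) $ i $ j =
    (\<Sum>is | length is = q. prod_list (map2 (\<lambda>i j. M $ i $ j) (i # is) (is @ [j])))"
proof (induction q arbitrary: i)
  case 0
  then show ?case by (simp add: mat_power_def)
next
  case (Suc q)
  have "mat_power M (Suc (Suc q)) $ i $ j = (\<Sum>k\<in>UNIV. M $ i $ k * mat_power M (Suc q) $ k $ j)"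
    by (simp add: mat_power_def matrix_matrix_mult_def)
  also have "\<dots> = (\<Sum>k\<in>UNIV. \<Sum>is | length is = q.
      prod_list (map2 (\<lambda>i j. M $ i $ j) (i # k # is) ((k # is) @ [j])))"
    by (simp add: Suc.IH sum_distrib_left)
  also have "\<dots> = (\<Sum>is | length is = Suc q. prod_list (map2 (\<lambda>i j. M $ i $ j) (i # is) (is @ [j])))"
    by (rule sum_lists_Suc[symmetric])
  finally show ?case .
qed

text \<open>The word of a closed walk: for indices \<open>i1, ..., ip\<close> the entries at
  \<open>(i1, i2), (i2, i3), ..., (ip, i1)\<close>.\<close>

definition cyclic_entries :: "'a^'n^'n \<Rightarrow> 'n list \<Rightarrow> 'a list" where
  "cyclic_entries M is = map2 (\<lambda>i j. M $ i $ j) is (rotate1 is)"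

lemma trace_mat_power:
  fixes M :: "'a::semiring_1^'n^'n"
  assumes "p \<ge> 1"
  shows "trace (mat_power M p) = (\<Sum>is | length is = p. prod_list (cyclic_entries M is))"
proof -
  obtain q where "p = Suc q" using assms by (cases p) auto
  then show ?thesis
    by (simp add: trace_def mat_power_Suc_entry sum_lists_Suc cyclic_entries_def)
qed

text \<open>One closed walk for each trace, obtained by cutting a single index list into pieces of
  lengths \<open>ps\<close>.\<close>

fun chunk_entries :: "('i \<Rightarrow> 'a^'n^'n) \<Rightarrow> 'i list \<Rightarrow> nat list \<Rightarrow> 'n list \<Rightarrow> 'a list list" where
  "chunk_entries A (l # ls) (p # ps) is =
     cyclic_entries (A l) (take p is) # chunk_entries A ls ps (drop p is)"
| "chunk_entries A _ _ _ = []"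

lemma map_length_chunk_entries:
  "length ps = length ls \<Longrightarrow> length is = sum_list ps \<Longrightarrow> map length (chunk_entries A ls ps is) = ps"
  by (induction A ls ps "is" rule: chunk_entries.induct) (auto simp: cyclic_entries_def)

lemma multilinear_sum:
  assumes "vector_space smul" "multilinear smul \<kappa>" "finite S"
  shows "\<kappa> (xs @ (\<Sum>s\<in>S. f s) # ys) = (\<Sum>s\<in>S. \<kappa> (xs @ f s # ys))"
proof -
  have add: "\<kappa> (xs @ (x + y) # ys) = \<kappa> (xs @ x # ys) + \<kappa> (xs @ y # ys)" for x y
    using assms(2) linear_functional_iff[OF assms(1), of "\<lambda>x. \<kappa> (xs @ x # ys)"]
    unfolding multilinear_def by simp
  have zero: "\<kappa> (xs @ 0 # ys) = 0" using add[of 0 0] by simp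
  show ?thesis using assms(3) by (induction S rule: finite_induct) (simp_all add: add zero)
qed

text \<open>The prefix \<open>xs\<close> holds the arguments that are already expanded, so that
  induction treats one trace at a time.\<close>

lemma cumulant_traces:
  fixes A :: "'i \<Rightarrow> 'a::ring_1^'n^'n"
  assumes v: "vector_space smul" and m: "multilinear smul \<kappa>"
    and "length ps = length ls" "\<forall>p\<in>set ps. p \<ge> 1"
  shows "\<kappa> (xs @ map2 (\<lambda>l p. trace (mat_power (A l) p)) ls ps) =
    (\<Sum>is | length is = sum_list ps. \<kappa> (xs @ map prod_list (chunk_entries A ls ps is)))"
  using assms(3,4)
proof (induction ps ls arbitrary: xs rule: list_induct2)
  case Nil
  then show ?case by simp
next
  case (Cons p ps l ls)
  let ?t = "map2 (\<lambda>l p. trace (mat_power (A l) p)) ls ps"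
  have "\<kappa> (xs @ trace (mat_power (A l) p) # ?t) =
      (\<Sum>is | length is = p. \<kappa> (xs @ prod_list (cyclic_entries (A l) is) # ?t))"
    using Cons.prems by (simp add: trace_mat_power multilinear_sum[OF v m finite_lists_length])
  also have "\<dots> = (\<Sum>is | length is = p. \<Sum>js | length js = sum_list ps.
      \<kappa> (xs @ map prod_list (chunk_entries A (l # ls) (p # ps) (is @ js))))"
  proof (intro sum.cong refl)
    fix "is" :: "'n list" assume "is \<in> {is. length is = p}"
    then show "\<kappa> (xs @ prod_list (cyclic_entries (A l) is) # ?t) =
        (\<Sum>js | length js = sum_list ps.
          \<kappa> (xs @ map prod_list (chunk_entries A (l # ls) (p # ps) (is @ js))))"
      using Cons.IH[of "xs @ [prod_list (cyclic_entries (A l) is)]"] Cons.prems by simp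
  qed
  also have "\<dots> = (\<Sum>is | length is = sum_list (p # ps).
      \<kappa> (xs @ map prod_list (chunk_entries A (l # ls) (p # ps) is)))"
    by (simp only: sum_lists_append sum_list.Cons)
  finally show ?case by simp
qed

text \<open>All closed walks at once: position \<open>x\<close> carries row index \<open>i x\<close>
  and column index \<open>i (\<gamma> x)\<close>.\<close>

definition chunk_indices :: "nat list \<Rightarrow> 'n list \<Rightarrow> ('n \<times> 'n) list" where
  "chunk_indices ps is = zip is (map (\<lambda>x. is ! block_succ ps x) [0..<sum_list ps])"

lemma entries_append:
  "length ls = length ijs \<Longrightarrow> entries A (ls @ ls') (ijs @ ijs') = entries A ls ijs @ entries A ls' ijs'"
  by (simp add: entries_def)

lemma concat_chunk_entries:
  assumes "length ps = length ls" "length is = sum_list ps"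
  shows "concat (chunk_entries A ls ps is) =
    entries A (concat (map2 (\<lambda>l p. replicate p l) ls ps)) (chunk_indices ps is)"
  using assms
proof (induction A ls ps "is" rule: chunk_entries.induct)
  case (1 A l ls p ps "is")
  have len: "p \<le> length is" "length (drop p is) = sum_list ps" using "1.prems" by auto
  have rot: "map (\<lambda>x. is ! block_succ (p # ps) x) [0..<p] = rotate1 (take p is)"
    using len by (intro nth_equalityI) (auto simp: nth_rotate1)
  \<comment> \<open>Beyond the first interval, \<open>block_succ\<close> is the one of the remaining
    intervals shifted by \<open>p\<close>.\<close>
  have upt: "[0..<p + sum_list ps] = [0..<p] @ map (\<lambda>x. p + x) [0..<sum_list ps]"
    by (intro nth_equalityI) (auto simp: nth_append)
  have "map (\<lambda>x. is ! block_succ (p # ps) x) [0..<sum_list (p # ps)] =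
      rotate1 (take p is) @ map (\<lambda>x. drop p is ! block_succ ps x) [0..<sum_list ps]"
    unfolding sum_list.Cons upt map_append rot using len(1) by simp
  then have "chunk_indices (p # ps) is =
      zip (take p is) (rotate1 (take p is)) @ chunk_indices ps (drop p is)"
    using zip_append[of "take p is" "rotate1 (take p is)" "drop p is"]
    by (simp add: chunk_indices_def)
  moreover have "cyclic_entries (A l) (take p is) =
      entries A (replicate p l) (zip (take p is) (rotate1 (take p is)))"
    using len by (intro nth_equalityI) (auto simp: cyclic_entries_def entries_def)
  ultimately show ?case
    using 1 len by (simp add: entries_append)
qed (auto simp: entries_def chunk_indices_def)

section \<open>From cyclic indices to index equations\<close>

lemma nths_zip:
  "length xs = length ys \<Longrightarrow> nths (zip xs ys) B = zip (nths xs B) (nths ys B)"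
  by (induction xs ys arbitrary: B rule: list_induct2) (auto simp: nths_Cons)

lemma nths_entries:
  "length ls = length ijs \<Longrightarrow> nths (entries A ls ijs) B = entries A (nths ls B) (nths ijs B)"
  by (simp add: entries_def nths_map nths_zip)

lemma nths_eq_map_sorted_list_of_set:
  assumes "B \<subseteq> {..<length xs}"
  shows "nths xs B = map ((!) xs) (sorted_list_of_set B)"
proof -
  have "sorted_list_of_set B = filter (\<lambda>i. i \<in> B) [0..<length xs]"
    using assms finite_subset[OF assms]
    by (intro sorted_distinct_set_unique) (auto simp: sorted_wrt_filter)
  moreover have "zip xs [0..<length xs] = map (\<lambda>i. (xs ! i, i)) [0..<length xs]"
    by (intro nth_equalityI) auto
  ultimately show ?thesis by (simp add: nths_def filter_map o_def)
qed

lemma cyclic_indices_map: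
  "cyclic_indices (map f xs) \<longleftrightarrow> (\<forall>(x, y)\<in>cyc_pairs xs. snd (f x) = fst (f y))"
proof -
  have "Suc k mod length xs < length xs" if "k < length xs" for k
    using that by (intro mod_less_divisor) auto
  moreover have "cyc_pairs xs = (\<lambda>k. (xs ! k, xs ! (Suc k mod length xs))) ` {..<length xs}"
    by (force simp: cyc_pairs_def set_zip nth_rotate1)
  ultimately show ?thesis
    by (auto simp: cyclic_indices_def)
qed

text \<open>Cyclicity within \<open>B\<close> equates the column index at \<open>x\<close>, which is
  \<open>i (\<gamma> x)\<close>, with the row index at the cyclic successor of \<open>x\<close> in
  \<open>B\<close>.\<close>

lemma cyclic_indices_nths_chunk_indices:
  assumes "B \<subseteq> {..<sum_list ps}" "length is = sum_list ps"
  shows "cyclic_indices (nths (chunk_indices ps is) B) \<longleftrightarrow>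
    (\<forall>(x, y)\<in>cyc_pairs (sorted_list_of_set B). is ! block_succ ps x = is ! y)"
proof -
  have B: "B \<subseteq> {..<length (chunk_indices ps is)}" using assms by (simp add: chunk_indices_def)
  have "x \<in> B \<and> y \<in> B" if "(x, y) \<in> cyc_pairs (sorted_list_of_set B)" for x y
    using set_zip_leftD[OF that[unfolded cyc_pairs_def]] set_zip_rightD[OF that[unfolded cyc_pairs_def]]
      finite_subset[OF assms(1)] by simp
  moreover have "fst (chunk_indices ps is ! x) = is ! x" "snd (chunk_indices ps is ! x) = is ! block_succ ps x"
    if "x \<in> B" for x
    using that assms by (auto simp: chunk_indices_def)
  ultimately show ?thesis
    unfolding nths_eq_map_sorted_list_of_set[OF B] cyclic_indices_map by fastforce
qed

text \<open>One block with noncyclic indices annihilates the product by R-cyclicity; if there is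
  none, every factor is the common value given by \<open>c\<close>.\<close>

lemma prod_block_cumulants:
  fixes A :: "'i \<Rightarrow> 'a^'n^'n"
  assumes R: "R_cyclic \<kappa> A" and C: "common_cyclic_cumulants \<kappa> A c"
    and P: "P \<in> ncp {..<sum_list ps}"
    and len: "length lls = sum_list ps" "length is = sum_list ps"
  shows "(\<Prod>B\<in>P. \<kappa> (nths (entries A lls (chunk_indices ps is)) B)) =
    (if is \<in> solutions (sum_list ps) (block_succ ps) (edges P) then block_prod c P lls else 0)"
proof -
  define cyc where "cyc B \<longleftrightarrow> cyclic_indices (nths (chunk_indices ps is) B)" for B
  have lenc: "length (chunk_indices ps is) = sum_list ps" using len by (simp add: chunk_indices_def)
  have "\<kappa> (nths (entries A lls (chunk_indices ps is)) B) = (if cyc B then c (nths lls B) else 0)"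
    if B: "B \<in> P" for B
  proof -
    have "nths lls B \<noteq> []" using P B len(1) nths_block_nonempty[of P lls B] by (simp add: NC_eq_ncp)
    moreover have "length (nths (chunk_indices ps is) B) = length (nths lls B)"
      using lenc len by (simp add: length_nths)
    moreover have "nths (entries A lls (chunk_indices ps is)) B =
        entries A (nths lls B) (nths (chunk_indices ps is) B)"
      using lenc len by (intro nths_entries) simp
    ultimately show ?thesis
      using R C unfolding R_cyclic_def common_cyclic_cumulants_def cyc_def by auto
  qed
  then have "(\<Prod>B\<in>P. \<kappa> (nths (entries A lls (chunk_indices ps is)) B)) =
      (\<Prod>B\<in>P. if cyc B then c (nths lls B) else 0)"
    by (intro prod.cong) auto
  also have "\<dots> = (if \<forall>B\<in>P. cyc B then block_prod c P lls else 0)"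
    using finite_ncp_elem[OF _ P] by (auto simp: block_prod_def intro!: prod_zero)
  also have "(\<forall>B\<in>P. cyc B) \<longleftrightarrow> is \<in> solutions (sum_list ps) (block_succ ps) (edges P)"
    using cyclic_indices_nths_chunk_indices[OF ncp_subset[OF P] len(2)] len(2)
    by (simp add: cyc_def solutions_def edges_def)
  finally show ?thesis .
qed

theorem lemma3p2:
  fixes smul :: "complex \<Rightarrow> 'a::ring_1 \<Rightarrow> 'a"
    and \<phi> :: "'a \<Rightarrow> complex"
    and \<kappa> :: "'a list \<Rightarrow> complex"
    and A :: "'i \<Rightarrow> 'a^'n^'n"
    and c :: "'i list \<Rightarrow> complex"
    and ls :: "'i list"
    and ps :: "nat list"
  assumes "nc_prob_space smul \<phi>"
    and "free_cumulants smul \<phi> \<kappa>"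
    and "R_cyclic \<kappa> A"
    and "common_cyclic_cumulants \<kappa> A c"
    and "ls \<noteq> []"
    and "length ps = length ls"
    and "\<forall>p\<in>set ps. p \<ge> 1"
  shows "\<kappa> (map2 (\<lambda>l p. trace (mat_power (A l) p)) ls ps) =
    of_nat CARD('n) powi (int (sum_list ps) + 2 - int (length ls)) *
    (\<Sum>\<pi> | \<pi> \<in> NC (sum_list ps) \<and>
           NC_join (sum_list ps) \<pi> (interval_partition ps) = {{..<sum_list ps}}.
       of_nat CARD('n) powi (- int (card \<pi>)) *
       block_prod c \<pi> (concat (map2 (\<lambda>l p. replicate p l) ls ps)))"
proof -
  interpret nc_prob_space smul \<phi> by fact
  define p where "p = sum_list ps"
  define lls where "lls = concat (map2 (\<lambda>l p. replicate p l) ls ps)"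
  define CN where "CN = conn_ncp (block_index ps) {..<p}"
  define n where "n = (of_nat CARD('n) :: complex)"
  have n: "n \<noteq> 0" by (simp add: n_def)
  have ps: "ps \<noteq> []" using assms(5,6) by auto
  have lls: "length lls = p"
    using assms(6) unfolding lls_def p_def by (induction ps ls rule: list_induct2) auto
  have sub: "P \<in> ncp {..<p}" if "P \<in> CN" for P
    using that conn_ncp_subset by (auto simp: CN_def)
  \<comment> \<open>For a fixed index list, the formula for products as arguments leaves the
    connected partitions, and R-cyclicity then selects those whose index equations hold.\<close>
  have chunk: "\<kappa> (map prod_list (chunk_entries A ls ps is)) =
      (\<Sum>P\<in>CN. if is \<in> solutions p (block_succ ps) (edges P) then block_prod c P lls else 0)"
    if len: "length is = p" for "is"
  proof -
    let ?xss = "chunk_entries A ls ps is"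
    have ml: "map length ?xss = ps"
      using map_length_chunk_entries assms(6) len by (simp add: p_def)
    \<comment> \<open>All exponents are positive, so no word is empty, as
      \<open>cumulant_of_products\<close> requires.\<close>
    have "length [] \<notin> length ` set ?xss" unfolding list.set_map[symmetric] ml using assms(7) by force
    then have "[] \<notin> set ?xss" by (metis imageI)
    moreover have "?xss \<noteq> []" using ps ml by (metis list.map_disc_iff)
    ultimately have "\<kappa> (map prod_list ?xss) =
        conn_sum (block_index ps) (\<lambda>B. \<kappa> (nths (concat ?xss) B)) {..<length (concat ?xss)}"
      using cumulant_of_products[OF assms(2), of ?xss] ml by simp
    also have "length (concat ?xss) = p" using ml by (simp add: length_concat p_def)
    also have "concat ?xss = entries A lls (chunk_indices ps is)"
      using concat_chunk_entries assms(6) len by (simp add: p_def lls_def)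
    finally have "\<kappa> (map prod_list ?xss) =
        (\<Sum>P\<in>CN. \<Prod>B\<in>P. \<kappa> (nths (entries A lls (chunk_indices ps is)) B))"
      by (simp add: conn_sum_def CN_def)
    also have "\<dots> = (\<Sum>P\<in>CN. if is \<in> solutions p (block_succ ps) (edges P) then block_prod c P lls else 0)"
      using prod_block_cumulants[OF assms(3,4)] sub lls len by (intro sum.cong) (auto simp: p_def)
    finally show ?thesis .
  qed
  \<comment> \<open>The division-free count is rewritten with integer powers, whose exponents may be
    negative.\<close>
  have card: "of_nat (card (solutions p (block_succ ps) (edges P) :: 'n list set)) =
      n powi (int p + 2 - int (length ls)) * n powi (- int (card P))" if P: "P \<in> CN" for P
  proof -
    let ?N = "card (solutions p (block_succ ps) (edges P) :: 'n list set)"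
    have "?N * CARD('n) ^ (card P + length ps) = CARD('n) ^ (p + 2)"
      using card_solutions[OF assms(7) ps, of P, where 'n = 'n] P by (simp add: p_def CN_def)
    then have "of_nat (?N * CARD('n) ^ (card P + length ps)) = (of_nat (CARD('n) ^ (p + 2)) :: complex)"
      by (rule arg_cong)
    then have eq: "of_nat ?N * (n ^ card P * n ^ length ps) = n ^ (p + 2)"
      by (simp add: n_def power_add)
    have "int p + 2 = int (p + 2)" by simp
    then have "n powi (int p + 2 - int (length ls)) = n ^ (p + 2) / n ^ length ps"
      using power_int_diff[of n "int (p + 2)" "int (length ls)"] n
      by (simp only: power_int_of_nat assms(6) simp_thms)
    moreover have "n powi (- int (card P)) = 1 / n ^ card P"
      by (simp add: power_int_minus divide_inverse)
    moreover have "of_nat ?N = n ^ (p + 2) / (n ^ card P * n ^ length ps)"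
      using n by (simp only: eq_divide_eq eq) simp
    ultimately show ?thesis by simp
  qed
  have "\<kappa> (map2 (\<lambda>l p. trace (mat_power (A l) p)) ls ps) =
      (\<Sum>is | length is = p. \<kappa> (map prod_list (chunk_entries A ls ps is)))"
    using cumulant_traces[OF vs1.vector_space_axioms _ assms(6,7), of \<kappa> "[]" A] assms(2)
    by (simp add: free_cumulants_def p_def)
  also have "\<dots> = (\<Sum>is :: 'n list | length is = p. \<Sum>P\<in>CN.
      if is \<in> solutions p (block_succ ps) (edges P) then block_prod c P lls else 0)"
    using chunk by (intro sum.cong) auto
  \<comment> \<open>After the exchange the inner sum counts the solutions belonging to a fixed
    partition.\<close>
  also have "\<dots> = (\<Sum>P\<in>CN. \<Sum>is :: 'n list | length is = p.
      if is \<in> solutions p (block_succ ps) (edges P) then block_prod c P lls else 0)"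
    by (rule sum.swap)
  also have "\<dots> = (\<Sum>P\<in>CN. of_nat (card (solutions p (block_succ ps) (edges P) :: 'n list set)) * block_prod c P lls)"
  proof (intro sum.cong refl)
    fix P
    have "{is :: 'n list. length is = p \<and> is \<in> solutions p (block_succ ps) (edges P)} =
        solutions p (block_succ ps) (edges P)"
      by (auto simp: solutions_def)
    then show "(\<Sum>is :: 'n list | length is = p.
        if is \<in> solutions p (block_succ ps) (edges P) then block_prod c P lls else 0) =
        of_nat (card (solutions p (block_succ ps) (edges P) :: 'n list set)) * block_prod c P lls"
      by (simp add: sum.inter_filter[OF finite_lists_length, symmetric])
  qed
  also have "\<dots> = n powi (int p + 2 - int (length ls)) *
      (\<Sum>P\<in>CN. n powi (- int (card P)) * block_prod c P lls)"
    unfolding sum_distrib_left by (intro sum.cong refl) (simp add: card mult.assoc)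
  also have "CN = {P. P \<in> NC p \<and> NC_join p P (interval_partition ps) = {{..<p}}}"
    using NC_join_eq_single_block_iff[OF assms(7) ps] sub by (auto simp: CN_def NC_eq_ncp p_def)
  finally show ?thesis by (simp add: n_def p_def lls_def)
qed

end
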